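(* Let $X$ be a complete and connected Riemannian manifold and $\mu_X$ a fully supported probability measure on $X$ absolutely continuous with respect to the volume measure such that its density is bounded from above on every ball in $X$. Assume that $(X,\mu_X)$ has positive Cheeger constant. Then there exists a measure $\nu\in\mathcal V$ such that $$I_X\circ V=V'\quad\mathcal L^1\text{-a.e.},$$ where $V$ is the cumulative distribution function of $\nu$.
   Context: $X$ carries its Riemannian distance. For a Borel set $A\subset X$, $\mu_X^+(A):=\limsup_{\varepsilon\to0+}\frac{\mu_X(U_\varepsilon(A))-\mu_X(A)}{\varepsilon}$, where $U_\varepsilon(A)$ is the open $\varepsilon$-neighborhood of $A$. The Cheeger constant is $h(X):=\inf_{0<\mu_X(A)<1}\frac{\mu_X^+(A)}{\min\{\mu_X(A),\mu_X(X\setminus A)\}}$, the infimum over Borel sets $A\subset X$. The isoperimetric profile is $I_X(v):=\inf\{\mu_X^+(A)\mid A\subset X\text{ Borel},\ \mu_X(A)=v\}$, for $v$ in the set $\operatorname{Im}\mu_X$ of values of $\mu_X$. $\mathcal V$ is the set of Borel probability measures on $\mathbb R$ absolutely continuous with respect to the Lebesgue measure $\mathcal L^1$ and with connected support; $V(t)=\nu((-\infty,t])$. *)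

theory Defs
  imports "HOL-Probability.Probability"
begin

subsection \<open>Riemannian manifolds\<close>

text \<open>
  \<^verbatim>\<open>Ck_on k f S\<close>: on the open set \<^verbatim>\<open>S\<close> all iterated directional derivatives of \<^verbatim>\<open>f\<close> of order at
  most \<^verbatim>\<open>k\<close> exist and are continuous.
\<close>

primrec Ck_on :: "nat \<Rightarrow> ('e::real_normed_vector \<Rightarrow> 'f::real_normed_vector) \<Rightarrow> 'e set \<Rightarrow> bool" where
  "Ck_on 0 f S \<longleftrightarrow> continuous_on S f"
| "Ck_on (Suc k) f S \<longleftrightarrow>
     (\<forall>x\<in>S. f differentiable (at x)) \<and> (\<forall>v. Ck_on k (\<lambda>x. frechet_derivative f (at x) v) S)"

definition smooth_on :: "('e::real_normed_vector \<Rightarrow> 'f::real_normed_vector) \<Rightarrow> 'e set \<Rightarrow> bool" where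
  "smooth_on f S \<longleftrightarrow> (\<forall>k. Ck_on k f S)"

text \<open>
  A chart is a pair of its domain and its coordinate map; the values of the coordinate map
  outside the domain are irrelevant. The dimension of the manifold is \<^verbatim>\<open>CARD('n)\<close>.
\<close>

type_synonym ('a, 'n) chart = "'a set \<times> ('a \<Rightarrow> real ^ 'n)"

abbreviation chart_dom :: "('a, 'n) chart \<Rightarrow> 'a set" where
  "chart_dom c \<equiv> fst c"

abbreviation chart_map :: "('a, 'n) chart \<Rightarrow> 'a \<Rightarrow> real ^ 'n" where
  "chart_map c \<equiv> snd c"

abbreviation chart_image :: "('a, 'n) chart \<Rightarrow> (real ^ 'n) set" where
  "chart_image c \<equiv> chart_map c ` chart_dom c"

abbreviation chart_inv :: "('a, 'n) chart \<Rightarrow> real ^ 'n \<Rightarrow> 'a" where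
  "chart_inv c \<equiv> inv_into (chart_dom c) (chart_map c)"

definition is_chart :: "('a::topological_space, 'n::finite) chart \<Rightarrow> bool" where
  "is_chart c \<longleftrightarrow> open (chart_dom c) \<and> open (chart_image c) \<and>
     homeomorphism (chart_dom c) (chart_image c) (chart_map c) (chart_inv c)"

definition transition :: "('a, 'n::finite) chart \<Rightarrow> ('a, 'n) chart \<Rightarrow> real ^ 'n \<Rightarrow> real ^ 'n" where
  "transition c c' = chart_map c' \<circ> chart_inv c"

definition smooth_atlas :: "('a::topological_space, 'n::finite) chart set \<Rightarrow> bool" where
  "smooth_atlas \<A> \<longleftrightarrow>
     (\<forall>c\<in>\<A>. is_chart c) \<and>
     (\<Union>c\<in>\<A>. chart_dom c) = UNIV \<and>
     (\<forall>c\<in>\<A>. \<forall>c'\<in>\<A>. smooth_on (transition c c') (chart_map c ` (chart_dom c \<inter> chart_dom c')))"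

text \<open>
  A metric tensor is given by its coordinate matrices: \<^verbatim>\<open>g c x\<close> is the Gram matrix of the
  coordinate basis of the chart \<^verbatim>\<open>c\<close> at the point with coordinates \<^verbatim>\<open>x\<close>. The last clause is the
  transformation law of a covariant 2-tensor.
\<close>

definition metric_tensor ::
  "('a::topological_space, 'n::finite) chart set \<Rightarrow>
   (('a, 'n) chart \<Rightarrow> real ^ 'n \<Rightarrow> real ^ 'n ^ 'n) \<Rightarrow> bool" where
  "metric_tensor \<A> g \<longleftrightarrow>
     (\<forall>c\<in>\<A>. smooth_on (g c) (chart_image c)) \<and>
     (\<forall>c\<in>\<A>. \<forall>x\<in>chart_image c.
        transpose (g c x) = g c x \<and> (\<forall>v. v \<noteq> 0 \<longrightarrow> 0 < v \<bullet> (g c x *v v))) \<and>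
     (\<forall>c\<in>\<A>. \<forall>c'\<in>\<A>. \<forall>x\<in>chart_map c ` (chart_dom c \<inter> chart_dom c').
        let J = jacobian (transition c c') (at x)
        in g c x = transpose J ** g c' (transition c c' x) ** J)"

definition piecewise_C1_curve ::
  "('a::topological_space, 'n::finite) chart set \<Rightarrow> (real \<Rightarrow> 'a) \<Rightarrow> bool" where
  "piecewise_C1_curve \<A> \<gamma> \<longleftrightarrow>
     continuous_on {0..1} \<gamma> \<and>
     (\<forall>c\<in>\<A>. \<forall>a b. 0 \<le> a \<and> a \<le> b \<and> b \<le> 1 \<and> \<gamma> ` {a..b} \<subseteq> chart_dom c \<longrightarrow>
        (chart_map c \<circ> \<gamma>) piecewise_C1_differentiable_on {a..b})"

text \<open>
  The norm of the velocity does not depend on the chart at \<^verbatim>\<open>\<gamma> t\<close> by the transformation law,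
  so an arbitrary one is selected. At the finitely many break points and at the two end points
  the value is meaningless; this does not affect the length.
\<close>

definition speed ::
  "('a, 'n::finite) chart set \<Rightarrow> (('a, 'n) chart \<Rightarrow> real ^ 'n \<Rightarrow> real ^ 'n ^ 'n) \<Rightarrow>
   (real \<Rightarrow> 'a) \<Rightarrow> real \<Rightarrow> real" where
  "speed \<A> g \<gamma> t =
     (let c = (SOME c. c \<in> \<A> \<and> \<gamma> t \<in> chart_dom c);
          v = vector_derivative (chart_map c \<circ> \<gamma>) (at t)
      in sqrt (v \<bullet> (g c (chart_map c (\<gamma> t)) *v v)))"

definition curve_length ::
  "('a, 'n::finite) chart set \<Rightarrow> (('a, 'n) chart \<Rightarrow> real ^ 'n \<Rightarrow> real ^ 'n ^ 'n) \<Rightarrow>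
   (real \<Rightarrow> 'a) \<Rightarrow> ennreal" where
  "curve_length \<A> g \<gamma> = (\<integral>\<^sup>+t\<in>{0..1}. ennreal (speed \<A> g \<gamma> t) \<partial>lborel)"

definition riemannian_distance ::
  "('a::topological_space, 'n::finite) chart set \<Rightarrow>
   (('a, 'n) chart \<Rightarrow> real ^ 'n \<Rightarrow> real ^ 'n ^ 'n) \<Rightarrow> 'a \<Rightarrow> 'a \<Rightarrow> ennreal" where
  "riemannian_distance \<A> g p q =
     (INF \<gamma>\<in>{\<gamma>. piecewise_C1_curve \<A> \<gamma> \<and> \<gamma> 0 = p \<and> \<gamma> 1 = q}. curve_length \<A> g \<gamma>)"

text \<open>
  A connected Riemannian manifold whose type-class distance is its Riemannian distance. Since
  the Riemannian distance of a connected manifold is finite and induces the manifold topology,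
  using the metric space topology for the charts is no restriction.
\<close>

definition connected_riemannian_manifold ::
  "('a::{metric_space, second_countable_topology}, 'n::finite) chart set \<Rightarrow>
   (('a, 'n) chart \<Rightarrow> real ^ 'n \<Rightarrow> real ^ 'n ^ 'n) \<Rightarrow> bool" where
  "connected_riemannian_manifold \<A> g \<longleftrightarrow>
     connected (UNIV :: 'a set) \<and> smooth_atlas \<A> \<and> metric_tensor \<A> g \<and>
     (\<forall>p q. ennreal (dist p q) = riemannian_distance \<A> g p q)"

text \<open>
  In a chart the volume is \<^verbatim>\<open>sqrt (det g)\<close> times Lebesgue measure. These measures, extended by
  zero outside the chart domain, agree on overlaps, so their supremum in the lattice of Borel
  measures is the measure obtained by gluing them.
\<close>

definition chart_volume ::
  "(('a, 'n) chart \<Rightarrow> real ^ 'n \<Rightarrow> real ^ 'n ^ 'n) \<Rightarrow>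
   ('a::topological_space, 'n::finite) chart \<Rightarrow> 'a measure" where
  "chart_volume g c =
     distr (density (restrict_space lborel (chart_image c)) (\<lambda>x. ennreal (sqrt (det (g c x)))))
       borel (chart_inv c)"

definition riemannian_volume ::
  "('a::topological_space, 'n::finite) chart set \<Rightarrow>
   (('a, 'n) chart \<Rightarrow> real ^ 'n \<Rightarrow> real ^ 'n ^ 'n) \<Rightarrow> 'a measure" where
  "riemannian_volume \<A> g = (SUP c\<in>\<A>. chart_volume g c)"

subsection \<open>Isoperimetry\<close>

definition measure_support :: "'a::topological_space measure \<Rightarrow> 'a set" where
  "measure_support M = {x. \<forall>U. open U \<and> x \<in> U \<longrightarrow> 0 < emeasure M U}"

definition open_nbhd :: "real \<Rightarrow> 'a::metric_space set \<Rightarrow> 'a set" where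
  "open_nbhd \<epsilon> A = (\<Union>a\<in>A. ball a \<epsilon>)"

definition boundary_measure :: "'a::metric_space measure \<Rightarrow> 'a set \<Rightarrow> ereal" where
  "boundary_measure \<mu> A =
     Limsup (at_right 0) (\<lambda>\<epsilon>. ereal ((measure \<mu> (open_nbhd \<epsilon> A) - measure \<mu> A) / \<epsilon>))"

definition cheeger_constant :: "'a::metric_space measure \<Rightarrow> ereal" where
  "cheeger_constant \<mu> =
     (INF A\<in>{A \<in> sets borel. 0 < measure \<mu> A \<and> measure \<mu> A < 1}.
        boundary_measure \<mu> A / ereal (min (measure \<mu> A) (measure \<mu> (- A))))"

text \<open>
  The profile takes the value \<^verbatim>\<open>\<infinity>\<close> (infimum of the empty set) at numbers that are not values of
  the measure. Hence an identity of the profile with a real number entails that the profile is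
  evaluated inside its domain of definition.
\<close>

definition isoperimetric_profile :: "'a::metric_space measure \<Rightarrow> real \<Rightarrow> ereal" where
  "isoperimetric_profile \<mu> v =
     (INF A\<in>{A \<in> sets borel. measure \<mu> A = v}. boundary_measure \<mu> A)"

definition connected_ac_distributions :: "real measure set" where
  "connected_ac_distributions =
     {\<nu>. prob_space \<nu> \<and> sets \<nu> = sets borel \<and> absolutely_continuous lborel \<nu> \<and>
          connected (measure_support \<nu>)}"

end

theory Submission
  imports Defs
begin

text \<open>
  The equation \<open>V' = I \<circ> V\<close>, with \<open>I\<close> the isoperimetric profile, is an autonomous differential
  equation and is solved by separating variables: put \<open>T v = \<integral> dw / I w\<close>, the integral
  running from \<open>1/2\<close> to \<open>v\<close>, and let \<open>V\<close> be the inverse function of \<open>T\<close>. Equivalently, \<open>\<nu>\<close> is the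
  image of the uniform distribution on \<open>(0,1)\<close> under \<open>T\<close>. The image of \<open>dw / I w\<close> under \<open>T\<close> is Lebesgue
  measure on the range of \<open>T\<close>; since \<open>dw = I w * dw / I w\<close>, the density of \<open>\<nu>\<close> is \<open>I \<circ> V\<close> on that range,
  and the Lebesgue differentiation theorem turns this into \<open>V' = I \<circ> V\<close> almost everywhere. Off
  the range of \<open>T\<close> the function \<open>V\<close> is 0 or 1, where the profile vanishes, as does \<open>V'\<close>. This is
  \<open>ex_distribution_with_derivative_profile\<close>.

  For this to work, \<open>1 / I\<close> must be measurable, locally integrable on \<open>(0,1)\<close> and almost everywhere
  positive. Local integrability is the Cheeger inequality \<open>h * min v (1 - v) \<le> I v\<close>. The two other
  points carry the proof.

  Measurability (\<open>profile_sublevel_lebesgue_measurable\<close>) holds in every metric probability space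
  with positive Cheeger constant. Suppose \<open>I v < c\<close>, and choose a set \<open>A\<close> of measure \<open>v\<close> whose boundary
  measure is less than some \<open>c' < c\<close>. The function \<open>\<phi> t = \<mu> (U\<^sub>t A)\<close> satisfies
  \<open>\<phi> t \<le> v + c' * t\<close> for small \<open>t\<close>. Moreover the boundary measure of \<open>U\<^sub>s A\<close> is at most the upper right
  derivative of \<open>\<phi>\<close> at \<open>s\<close>; so the Cheeger inequality bounds the growth of \<open>\<phi>\<close> from below by a
  positive rate, and \<open>\<phi> s\<close> lies in the sublevel set \<open>{I < c}\<close> whenever \<open>\<phi>\<close> grows more slowly than \<open>c\<close>
  at \<open>s\<close>. The two bounds together force such values \<open>\<phi> s\<close> to occupy a fixed proportion of every
  short interval \<open>(v, v + \<delta>)\<close> (\<open>steep_function_slow_values\<close>). Thus each point of the sublevel set has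
  positive lower right density with respect to a Borel subset of it, and by the Lebesgue density
  theorem such a set is Lebesgue measurable (\<open>right_density_imp_lebesgue_measurable\<close>).

  For almost every \<open>v\<close> the profile is finite (\<open>AE_isoperimetric_profile_finite\<close>), because the manifold can be filled up
  continuously by sets with finite boundary measure. A chart is Lipschitz near a point for
  the Riemannian distance, so an \<open>\<epsilon>\<close>-neighbourhood of a coordinate ball lies in a coordinate ball
  with a radius larger by \<open>L * \<epsilon>\<close>; hence for almost every radius the ball has finite boundary measure. Countably
  many coordinate balls cover the manifold, and adding them one after the other, each with
  growing radius, yields the sublevel sets of a single function \<open>f\<close>. The image of \<open>\<mu>\<close> under \<open>f\<close> is
  absolutely continuous, so its quantile function takes almost every \<open>v\<close> to a level at which the
  sublevel set of \<open>f\<close> has measure \<open>v\<close> and finite boundary measure.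
\<close>

section \<open>Differentiation of distribution functions\<close>

text \<open>
  The library's theorem on averages over cubes with a corner at \<open>x\<close> gives right derivatives in
  dimension one; reflection at the origin will give the left ones.
\<close>

lemma lebesgue_right_derivative:
  fixes f :: "real \<Rightarrow> real"
  assumes "integrable lborel f"
  shows "AE x in lborel. \<forall>e>0. \<exists>d>0. \<forall>h. 0 < h \<and> h < d \<longrightarrow> \<bar>integral {x..x+h} f / h - f x\<bar> < e"
proof -
  have "f integrable_on cbox a b" for a b
    using assms integrable_on_lborel integrable_on_subcbox
    by (metis subset_UNIV)
  from integrable_ccontinuous_explicit[OF this] obtain N where N: "negligible N"
    "\<And>x e. \<lbrakk>x \<notin> N; 0 < e\<rbrakk> \<Longrightarrow> \<exists>d>0. \<forall>h. 0 < h \<and> h < d \<longrightarrow>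
        norm (integral (cbox x (x + h *\<^sub>R One)) f /\<^sub>R h ^ DIM(real) - f x) < e"
    by blast
  have "AE x in lebesgue. x \<notin> N"
    using N(1) by (simp add: AE_not_in negligible_iff_null_sets)
  then have "AE x in lebesgue. \<forall>e>0. \<exists>d>0. \<forall>h. 0 < h \<and> h < d \<longrightarrow> \<bar>integral {x..x+h} f / h - f x\<bar> < e"
    by eventually_elim (use N(2) in \<open>simp add: field_simps\<close>)
  then show ?thesis by (simp add: AE_completion_iff)
qed

lemma lebesgue_left_derivative:
  fixes f :: "real \<Rightarrow> real"
  assumes "integrable lborel f"
  shows "AE x in lborel. \<forall>e>0. \<exists>d>0. \<forall>h. 0 < h \<and> h < d \<longrightarrow> \<bar>integral {x-h..x} f / h - f x\<bar> < e"
proof -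
  define f' where "f' = (\<lambda>x. f (- x))"
  have "integrable lborel f'"
    using lborel_integrable_real_affine[OF assms, of "-1" 0] by (simp add: f'_def)
  from lebesgue_right_derivative[OF this]
  have "AE x in distr lborel borel uminus. \<forall>e>0. \<exists>d>0. \<forall>h. 0 < h \<and> h < d \<longrightarrow>
      \<bar>integral {x..x+h} f' / h - f' x\<bar> < e"
    by (simp only: lborel_distr_uminus)
  then have "AE x in lborel. \<forall>e>0. \<exists>d>0. \<forall>h. 0 < h \<and> h < d \<longrightarrow>
      \<bar>integral {-x..-x+h} f' / h - f' (- x)\<bar> < e"
    by (rule AE_distrD[rotated]) simp
  moreover have "integral {-x..-x+h} f' = integral {x-h..x} f" for x h
    using Henstock_Kurzweil_Integration.integral_reflect_real[of "x" "x-h" "f"]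
    by (simp add: f'_def algebra_simps)
  ultimately show ?thesis by (simp add: f'_def)
qed

text \<open>
  The Lebesgue differentiation theorem on the real line: at almost every point the left and the right
  averages of \<open>g\<close> converge to the same value.
\<close>

theorem cdf_density_derivative:
  fixes g :: "real \<Rightarrow> real"
  assumes "integrable lborel g" "\<And>x. 0 \<le> g x"
  shows "AE x in lborel. (cdf (density lborel g) has_real_derivative g x) (at x)"
  using lebesgue_right_derivative[OF assms(1)] lebesgue_left_derivative[OF assms(1)]
proof eventually_elim
  case (elim x)
  let ?M = "density lborel g"
  have [measurable]: "g \<in> borel_measurable borel" using assms(1) by auto
  have fin: "finite_measure ?M"
    using assms by (intro finite_measureI)
      (simp add: emeasure_density nn_integral_eq_integral)
  interpret finite_measure ?M by fact
  have M: "cdf ?M b - cdf ?M a = integral {a..b} g" if "a \<le> b" for a b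
  proof -
    have "cdf ?M b - cdf ?M a = measure ?M ({..b} - {..a})"
      using that unfolding cdf_def by (subst finite_measure_Diff) auto
    also have "{..b} - {..a} = {a<..b}" by auto
    also have "measure ?M {a<..b} = (LINT x|lborel. indicator {a<..b} x * g x)"
    proof -
      have "integrable lborel (\<lambda>x. indicator {a<..b} x * g x)"
        using integrable_mult_indicator[OF _ assms(1), of "{a<..b}"] by simp
      then have "emeasure ?M {a<..b} = ennreal (LINT x|lborel. indicator {a<..b} x * g x)"
        by (subst nn_integral_eq_integral[symmetric])
           (auto simp: emeasure_density assms(2) mult.commute ennreal_mult' ennreal_indicator
             intro!: nn_integral_cong split: split_indicator)
      then show ?thesis unfolding measure_def
        by (simp add: assms(2) integral_nonneg_AE)
    qed
    also have "\<dots> = (LINT x:{a..b}|lborel. g x)"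
      unfolding set_lebesgue_integral_def
      by (rule integral_cong_AE)
         (use AE_lborel_singleton[of a] in \<open>auto elim!: eventually_mono split: split_indicator\<close>)
    also have "\<dots> = integral {a..b} g"
      by (rule set_borel_integral_eq_integral)
         (use integrable_mult_indicator[OF _ assms(1), of "{a..b}"] in \<open>simp add: set_integrable_def\<close>)
    finally show ?thesis .
  qed
  show ?case
    unfolding DERIV_def LIM_eq
  proof (intro allI impI)
    fix e :: real assume "0 < e"
    obtain d1 where d1: "d1 > 0" "\<forall>h. 0 < h \<and> h < d1 \<longrightarrow> \<bar>integral {x..x+h} g / h - g x\<bar> < e"
      using elim \<open>0 < e\<close> by blast
    obtain d2 where d2: "d2 > 0" "\<forall>h. 0 < h \<and> h < d2 \<longrightarrow> \<bar>integral {x-h..x} g / h - g x\<bar> < e"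
      using elim \<open>0 < e\<close> by blast
    show "\<exists>s>0. \<forall>h. h \<noteq> 0 \<and> norm (h - (0::real)) < s \<longrightarrow>
        norm ((cdf ?M (x + h) - cdf ?M x) / h - g x) < e"
    proof (intro exI[of _ "min d1 d2"] conjI allI impI)
      show "0 < min d1 d2" using d1 d2 by simp
      fix h :: real assume h: "h \<noteq> 0 \<and> norm (h - 0) < min d1 d2"
      show "norm ((cdf ?M (x + h) - cdf ?M x) / h - g x) < e"
      proof (cases "h > 0")
        case True
        then show ?thesis using h d1 M[of x "x+h"] by auto
      next
        case False
        define k where "k = - h"
        have k: "0 < k" "k < d2" "h = - k" using False h by (auto simp: k_def)
        have "(cdf ?M (x + h) - cdf ?M x) / h = integral {x-k..x} g / k"
          using k M[of "x-k" x] by (simp add: minus_divide_right[symmetric] field_simps)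
        then show ?thesis using k d2 by auto
      qed
    qed
  qed
qed

corollary absolutely_continuous_cdf_derivative:
  fixes M :: "real measure"
  assumes "finite_measure M" "sets M = sets borel" "absolutely_continuous lborel M"
  obtains g :: "real \<Rightarrow> real" where "g \<in> borel_measurable borel" "\<And>x. 0 \<le> g x" "M = density lborel g"
    "AE x in lborel. (cdf M has_real_derivative g x) (at x)"
proof -
  interpret finite_measure M by fact
  have dens: "density lborel (RN_deriv lborel M) = M"
    by (intro sigma_finite_measure.density_RN_deriv sigma_finite_lborel assms) (simp add: assms)
  have fin: "AE x in lborel. RN_deriv lborel M x \<noteq> \<infinity>"
    by (intro sigma_finite_measure.RN_deriv_finite sigma_finite_lborel)
       (use assms dens in \<open>auto simp: sigma_finite_measure_axioms\<close>)
  define g where "g = (\<lambda>x. enn2real (RN_deriv lborel M x))"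
  have [measurable]: "g \<in> borel_measurable borel" by (simp add: g_def)
  have g0: "0 \<le> g x" for x by (simp add: g_def)
  have M: "M = density lborel g"
    by (subst dens[symmetric], rule density_cong)
       (use fin in \<open>auto simp: g_def less_top elim!: eventually_mono\<close>)
  have "integrable lborel g"
  proof (rule integrableI_nonneg)
    have "(\<integral>\<^sup>+x. ennreal (g x) \<partial>lborel) = emeasure M (space M)"
      by (subst (1) M) (simp add: emeasure_density  assms(2) sets_eq_imp_space_eq)
    then show "(\<integral>\<^sup>+x. ennreal (g x) \<partial>lborel) < \<infinity>" by (simp add: less_top[symmetric])
  qed (auto simp: g0)
  from cdf_density_derivative[OF this g0] show ?thesis
    using g0 M by (intro that[of g]) auto
qed

text \<open>
  At an atom the distribution function jumps, and its value at the quantile may exceed \<open>w\<close>;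
  continuity excludes this.
\<close>

lemma (in cdf_distribution) cdf_quantile:
  assumes "continuous_on UNIV (cdf M)" "0 < w" "w < 1"
  shows "cdf M (Inf {x. w \<le> cdf M x}) = w"
proof (rule antisym)
  let ?q = "Inf {x. w \<le> cdf M x}"
  show "w \<le> cdf M ?q" using pseudoinverse[OF assms(2,3)] by blast
  have "isCont (cdf M) ?q" using assms(1) by (simp add: continuous_on_eq_continuous_at)
  then have "(cdf M \<longlongrightarrow> cdf M ?q) (at_left ?q)"
    by (metis at_le continuous_within tendsto_mono subset_UNIV)
  moreover have "\<forall>\<^sub>F x in at_left ?q. cdf M x \<le> w"
  proof -
    have "\<forall>\<^sub>F x in at_left ?q. x < ?q" by (simp add: eventually_at_filter)
    then show ?thesis
  proof eventually_elim
    case (elim x)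
    then show ?case using pseudoinverse[OF assms(2,3), of x] by linarith
  qed
  qed
  ultimately show "cdf M ?q \<le> w"
    by (rule tendsto_upperbound) simp
qed

text \<open>
  The quantile function maps the uniform distribution to \<open>M\<close>. Hence a property that fails only on an
  \<open>M\<close>-null set holds at the \<open>w\<close>-quantile for almost every level \<open>w\<close>.
\<close>

lemma (in cdf_distribution) AE_quantile:
  assumes "AE x in M. P x"
  shows "AE w in lborel. 0 < w \<and> w < 1 \<longrightarrow> P (Inf {x. w \<le> cdf M x})"
proof -
  have I: "I \<in> restrict_space lborel {0<..<1} \<rightarrow>\<^sub>M borel"
    using measurable_CI by (simp add: measurable_def space_restrict_space sets_restrict_space)
  have "AE x in distr (restrict_space lborel {0<..<1}) borel I. P x"
    using assms by (simp only: distr_I_eq_M)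
  from AE_distrD[OF I this] have "AE w in restrict_space lborel {0<..<1}. P (Inf {x. w \<le> cdf M x})" .
  then show ?thesis
    by (subst (asm) AE_restrict_space_iff) auto
qed

text \<open>
  A Lipschitz distribution function takes a null set \<open>N\<close> to a null set of levels. Since every level
  is the value of the distribution function at its quantile, almost no quantile lies in \<open>N\<close>.
\<close>

lemma lipschitz_cdf_imp_absolutely_continuous:
  assumes "real_distribution M" and lip: "\<And>x y. x \<le> y \<Longrightarrow> cdf M y - cdf M x \<le> L * (y - x)"
  shows "absolutely_continuous lborel M"
  unfolding absolutely_continuous_def
proof
  interpret cdf_distribution M using assms(1) by (simp add: cdf_distribution_def)
  fix N :: "real set" assume N: "N \<in> null_sets lborel"
  have lip': "\<bar>cdf M y - cdf M x\<bar> \<le> \<bar>L\<bar> * \<bar>y - x\<bar>" for x y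
  proof -
    have *: "\<bar>cdf M y - cdf M x\<bar> \<le> \<bar>L\<bar> * \<bar>y - x\<bar>" if "x \<le> y" for x y
    proof -
      have "L * (y - x) \<le> \<bar>L\<bar> * (y - x)" using that by (intro mult_right_mono) auto
      then show ?thesis using lip[OF that] cdf_nondecreasing[OF that] that by auto
    qed
    show ?thesis
      using *[of x y] *[of y x] by (cases "x \<le> y") (auto simp: abs_minus_commute)
  qed
  have cont: "continuous_on UNIV (cdf M)"
  proof (rule lipschitz_on_continuous_on)
    show "\<bar>L\<bar>-lipschitz_on UNIV (cdf M)"
      using lip' by (intro lipschitz_onI) (auto simp: dist_real_def)
  qed
  have "negligible (cdf M ` N)"
  proof (rule negligible_locally_Lipschitz_image)
    show "negligible N" using N by (simp add: negligible_iff_null_sets null_sets_completionI)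
    fix x show "\<exists>T B. open T \<and> x \<in> T \<and> (\<forall>y\<in>N \<inter> T. norm (cdf M y - cdf M x) \<le> B * norm (y - x))"
      using lip' by (intro exI[of _ UNIV] exI[of _ "\<bar>L\<bar>"]) auto
  qed simp
  then have "AE w in lebesgue. w \<notin> cdf M ` N"
    by (simp add: AE_not_in negligible_iff_null_sets)
  then have *: "AE w in lborel. w \<notin> cdf M ` N" by (simp add: AE_completion_iff)
  have "AE x in distr (restrict_space lborel {0<..<1}) borel I. x \<notin> N"
  proof (subst AE_distr_iff)
    show "I \<in> restrict_space lborel {0<..<1} \<rightarrow>\<^sub>M borel"
      using measurable_CI by (simp add: measurable_def space_restrict_space sets_restrict_space)
    show "{x \<in> space borel. x \<notin> N} \<in> sets borel" using N by (auto simp: null_sets_def Compl_eq[symmetric])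
    have "AE w in lborel. 0 < w \<and> w < 1 \<longrightarrow> I w \<notin> N"
      using * by eventually_elim (metis cdf_quantile[OF cont] imageI)
    then show "AE w in restrict_space lborel {0<..<1}. I w \<notin> N"
      by (subst AE_restrict_space_iff) auto
  qed
  then have "AE x in M. x \<notin> N" by (simp only: distr_I_eq_M)
  then show "N \<in> null_sets M"
    using N by (subst AE_iff_null_sets) (auto simp: null_sets_def)
qed

section \<open>Slow values of steep functions\<close>

text \<open>
  A lower bound on the upper right derivative integrates: the supremum of the points up to
  which the growth estimate holds satisfies it too, by monotonicity, and would otherwise be passed by one more step.
\<close>

lemma mono_frequently_steep_imp_steep:
  fixes \<phi> :: "real \<Rightarrow> real"
  assumes mono: "\<And>x y. 0 \<le> x \<Longrightarrow> x \<le> y \<Longrightarrow> \<phi> x \<le> \<phi> y" and m: "0 \<le> m"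
    and freq: "\<And>s. 0 \<le> s \<Longrightarrow> s < t0 \<Longrightarrow> \<exists>\<^sub>F \<epsilon> in at_right 0. m * \<epsilon> \<le> \<phi> (s + \<epsilon>) - \<phi> s"
    and xy: "0 \<le> x" "x \<le> y" "y \<le> t0"
  shows "m * (y - x) \<le> \<phi> y - \<phi> x"
proof -
  define S where "S = {s. x \<le> s \<and> s \<le> y \<and> m * (s - x) \<le> \<phi> s - \<phi> x}"
  have x: "x \<in> S" using xy by (simp add: S_def)
  have bdd: "bdd_above S" by (rule bdd_aboveI[of _ y]) (simp add: S_def)
  define \<sigma> where "\<sigma> = Sup S"
  have \<sigma>: "x \<le> \<sigma>" unfolding \<sigma>_def using x bdd by (rule cSup_upper)
  have "s \<le> y" if "s \<in> S" for s using that by (simp add: S_def)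
  then have \<sigma>y: "\<sigma> \<le> y" unfolding \<sigma>_def using x by (intro cSup_least) auto
  note \<sigma> = \<sigma> \<sigma>y
  have "\<phi> x + m * (\<sigma> - x) \<le> \<phi> \<sigma>"
  proof -
    have le: "\<phi> x + m * (s - x) \<le> \<phi> \<sigma>" if "s \<in> S" for s
    proof -
      have "s \<le> \<sigma>" unfolding \<sigma>_def using that bdd by (rule cSup_upper)
      then have "\<phi> s \<le> \<phi> \<sigma>" using mono that xy by (auto simp: S_def)
      then show ?thesis using that by (simp add: S_def)
    qed
    show ?thesis
    proof (cases "m = 0")
      case True then show ?thesis using le[OF x] by simp
    next
      case False
      then have "s \<le> x + (\<phi> \<sigma> - \<phi> x) / m" if "s \<in> S" for s using le[OF that] m by (simp add: field_simps)
      then have "\<sigma> \<le> x + (\<phi> \<sigma> - \<phi> x) / m" unfolding \<sigma>_def[of] using x by (intro cSup_least) auto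
      then show ?thesis using False m by (simp add: field_simps)
    qed
  qed
  then have \<sigma>S: "\<sigma> \<in> S" using \<sigma> by (simp add: S_def)
  have "\<sigma> = y"
  proof (rule ccontr)
    assume "\<sigma> \<noteq> y"
    then have "\<sigma> < y" using \<sigma> by simp
    have "\<exists>\<^sub>F \<epsilon> in at_right 0. m * \<epsilon> \<le> \<phi> (\<sigma> + \<epsilon>) - \<phi> \<sigma>" using freq[of \<sigma>] \<sigma> xy \<open>\<sigma> < y\<close> by simp
    moreover have "\<forall>\<^sub>F \<epsilon> in at_right 0. \<epsilon> < y - \<sigma> \<and> 0 < \<epsilon>"
      using \<open>\<sigma> < y\<close> by (auto intro!: eventually_conj eventually_at_right_less
        order_tendstoD(2)[of "\<lambda>x. x", OF tendsto_ident_at])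
    ultimately obtain \<epsilon> where e: "m * \<epsilon> \<le> \<phi> (\<sigma> + \<epsilon>) - \<phi> \<sigma>" "\<epsilon> < y - \<sigma>" "0 < \<epsilon>"
      by (metis (mono_tags, lifting) frequently_ex frequently_eventually_frequently)
    have "m * (\<sigma> + \<epsilon> - x) \<le> \<phi> (\<sigma> + \<epsilon>) - \<phi> x"
      using e(1) \<sigma>S by (simp add: S_def algebra_simps)
    then have "\<sigma> + \<epsilon> \<in> S" using e \<sigma> by (simp add: S_def)
    then have "\<sigma> + \<epsilon> \<le> \<sigma>" unfolding \<sigma>_def using bdd by (intro cSup_upper) auto
    then show False using e by simp
  qed
  then show ?thesis using \<sigma>S by (simp add: S_def)
qed

lemma mono_const_interval_derivative:
  fixes f :: "real \<Rightarrow> real"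
  assumes f: "mono f" "f a = f b" "a < b" and d: "(f has_real_derivative d) (at x)" "a \<le> x" "x \<le> b"
  shows "d = 0"
proof -
  have const: "f y = f a" if "y \<in> {a..b}" for y
    using that f(2) monoD[OF f(1), of a y] monoD[OF f(1), of y b] by auto
  have *: "((\<lambda>_. f a) has_real_derivative d) (at x within {a..b})"
    by (rule has_field_derivative_transform_within[OF has_field_derivative_at_within[OF d(1)], of 1])
       (use d in \<open>auto intro: const\<close>)
  have "((\<lambda>_. f a) has_real_derivative 0) (at x within {a..b})" by simp
  moreover have "at x within {a..b} \<noteq> bot"
    using d \<open>a < b\<close> by (simp add: trivial_limit_within islimpt_Icc)
  ultimately show ?thesis using * has_field_derivative_unique by blast
qed

text \<open>
  The function \<open>\<phi>\<close> may jump; its inverse \<open>\<psi>\<close> is constant across the gap and in this way becomes defined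
  and Lipschitz on the whole line.
\<close>

lemma lipschitz_inverse_of_steep_function:
  fixes \<phi> :: "real \<Rightarrow> real"
  assumes t0: "0 < t0" and m: "0 < m"
    and steep: "\<And>x y. 0 \<le> x \<Longrightarrow> x \<le> y \<Longrightarrow> y \<le> t0 \<Longrightarrow> m * (y - x) \<le> \<phi> y - \<phi> x"
  obtains \<psi> where "mono \<psi>" "\<And>w. 0 \<le> \<psi> w" "\<And>w. \<psi> w \<le> t0"
    "\<And>x y. x \<le> y \<Longrightarrow> \<psi> y - \<psi> x \<le> (y - x) / m" "\<And>s. 0 \<le> s \<Longrightarrow> s \<le> t0 \<Longrightarrow> \<psi> (\<phi> s) = s"
    "\<And>w. w \<le> \<phi> 0 \<Longrightarrow> \<psi> w = 0" "\<And>w. \<phi> t0 \<le> w \<Longrightarrow> \<psi> w = t0"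
proof -
  define R where "R w = insert 0 {s. 0 \<le> s \<and> s \<le> t0 \<and> \<phi> s \<le> w}" for w
  define \<psi> where "\<psi> w = Sup (R w)" for w
  have bdd: "bdd_above (R w)" for w unfolding R_def using t0 by (intro bdd_aboveI[of _ t0]) auto
  have ne: "R w \<noteq> {}" for w by (simp add: R_def)
  have up: "s \<le> \<psi> w" if "s \<in> R w" for s w unfolding \<psi>_def using that bdd by (rule cSup_upper)
  have strict: "\<phi> x < \<phi> y" if "0 \<le> x" "x < y" "y \<le> t0" for x y
  proof -
    have "0 < m * (y - x)" using m that by simp
    then show ?thesis using steep[of x y] that by auto
  qed
  have mono: "\<psi> x \<le> \<psi> y" if "x \<le> y" for x y
    unfolding \<psi>_def using that by (intro cSup_subset_mono ne bdd) (auto simp: R_def)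
  have lo: "0 \<le> \<psi> w" for w by (rule up) (simp add: R_def)
  have hi: "\<psi> w \<le> t0" for w
    unfolding \<psi>_def using t0 by (intro cSup_least ne) (auto simp: R_def)
  have lip: "\<psi> y - \<psi> x \<le> (y - x) / m" if "x \<le> y" for x y
  proof -
    have "s' \<le> \<psi> x + (y - x) / m" if s': "s' \<in> R y" for s'
    proof (cases "s' \<le> \<psi> x")
      case True
      then show ?thesis using m \<open>x \<le> y\<close> by (simp add: add_increasing2)
    next
      case False
      then have s'': "\<phi> s' \<le> y" "s' \<le> t0" using s' lo[of x] by (auto simp: R_def)
      have "s' - (y - x) / m \<le> s" if s: "\<psi> x < s" "s < s'" for s
      proof -
        have "s \<notin> R x" using up s(1) by force
        then have "\<phi> s > x" using s s'' lo[of x] by (auto simp: R_def)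
        moreover have "m * (s' - s) \<le> \<phi> s' - \<phi> s" using s s'' lo[of x] by (intro steep) auto
        ultimately have "m * (s' - s) \<le> y - x" using s'' by linarith
        then show ?thesis using m by (simp add: field_simps)
      qed
      then have "s' - (y - x) / m \<le> \<psi> x" using False by (intro dense_ge_bounded[of "\<psi> x" s']) auto
      then show ?thesis by linarith
    qed
    then have "\<psi> y \<le> \<psi> x + (y - x) / m" unfolding \<psi>_def[of y] by (intro cSup_least ne)
    then show ?thesis by linarith
  qed
  have inv: "\<psi> (\<phi> s) = s" if "0 \<le> s" "s \<le> t0" for s
  proof (rule antisym)
    show "\<psi> (\<phi> s) \<le> s"
      unfolding \<psi>_def
    proof (intro cSup_least ne)
      fix r assume "r \<in> R (\<phi> s)"
      then show "r \<le> s" using that strict[of s r] by (cases "s < r") (auto simp: R_def)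
    qed
    show "s \<le> \<psi> (\<phi> s)" using that by (intro up) (auto simp: R_def)
  qed
  have "\<psi> w = 0" if "w \<le> \<phi> 0" for w using mono[OF that] inv[of 0] t0 lo[of w] by auto
  moreover have "\<psi> w = t0" if "\<phi> t0 \<le> w" for w using mono[OF that] inv[of t0] t0 hi[of w] by auto
  ultimately show ?thesis
    using mono lo hi lip inv by (intro that[of \<psi>]) (auto intro: monoI)
qed

text \<open>
  The set \<open>E\<close> consists of the values \<open>w\<close> where the inverse \<open>\<psi>\<close> of \<open>\<phi>\<close> has a derivative greater than \<open>1 / c\<close>. At such
  a \<open>w\<close> there is no jump, since \<open>\<psi>\<close> is constant across jumps, and \<open>\<phi>\<close> grows more slowly than \<open>c\<close>. To bound the size
  of \<open>E\<close>, integrate \<open>\<psi>'\<close> over the interval from \<open>\<phi> 0\<close> to \<open>\<phi> t\<close>. The integral is \<open>t\<close>; the integrand is at most \<open>1 / m\<close> on \<open>E\<close>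
  and at most \<open>1 / c\<close> elsewhere; the interval has length at most \<open>c' * t\<close>. Hence
  \<open>t \<le> |E| / m + c' * t / c\<close>.
\<close>

theorem steep_function_slow_values:
  fixes \<phi> :: "real \<Rightarrow> real"
  assumes t0: "0 < t0" and m: "0 < m" and c: "c' < c"
    and steep: "\<And>x y. 0 \<le> x \<Longrightarrow> x \<le> y \<Longrightarrow> y \<le> t0 \<Longrightarrow> m * (y - x) \<le> \<phi> y - \<phi> x"
    and slow: "\<And>t. 0 \<le> t \<Longrightarrow> t \<le> t0 \<Longrightarrow> \<phi> t \<le> \<phi> 0 + c' * t"
  obtains E where "E \<in> sets borel"
    "\<And>w. w \<in> E \<Longrightarrow> \<exists>s. 0 \<le> s \<and> s < t0 \<and> \<phi> s = w \<and> (\<forall>\<^sub>F \<epsilon> in at_right 0. \<phi> (s + \<epsilon>) - \<phi> s \<le> c * \<epsilon>)"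
    "\<And>t. 0 < t \<Longrightarrow> t \<le> t0 \<Longrightarrow> m * (1 - c' / c) * t \<le> measure lborel (E \<inter> {\<phi> 0<..\<phi> 0 + c' * t})"
proof -
  obtain \<psi> where \<psi>: "mono \<psi>" "\<And>w. 0 \<le> \<psi> w" "\<And>w. \<psi> w \<le> t0"
    "\<And>x y. x \<le> y \<Longrightarrow> \<psi> y - \<psi> x \<le> (y - x) / m" "\<And>s. 0 \<le> s \<Longrightarrow> s \<le> t0 \<Longrightarrow> \<psi> (\<phi> s) = s"
    "\<And>w. w \<le> \<phi> 0 \<Longrightarrow> \<psi> w = 0" "\<And>w. \<phi> t0 \<le> w \<Longrightarrow> \<psi> w = t0"
    by (rule lipschitz_inverse_of_steep_function[OF t0 m steep]) (assumption+, rule that)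
  have "m * (t0 - 0) \<le> \<phi> t0 - \<phi> 0" using t0 by (intro steep) auto
  moreover have "\<phi> t0 \<le> \<phi> 0 + c' * t0" using t0 by (intro slow) auto
  ultimately have "m * t0 \<le> c' * t0" by simp
  then have "m \<le> c'" using t0 by (simp add: mult_right_le_imp_le)
  then have c': "m \<le> c'" "0 < c'" "0 < c" using m c by auto
  \<comment> \<open>Division by \<open>t0\<close> makes \<open>\<psi>\<close> the distribution function of a probability measure.\<close>
  define F where "F w = \<psi> w / t0" for w
  have monoF: "F x \<le> F y" if "x \<le> y" for x y
    using that \<psi>(1) t0 by (simp add: F_def divide_right_mono monoD)
  have lipF: "F y - F x \<le> (1 / (m * t0)) * (y - x)" if "x \<le> y" for x y
  proof -
    have "(\<psi> y - \<psi> x) / t0 \<le> ((y - x) / m) / t0" using \<psi>(4)[OF that] t0 by (intro divide_right_mono) auto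
    then show ?thesis by (simp add: F_def diff_divide_distrib field_simps)
  qed
  have contF: "isCont F x" for x
  proof -
    have "(1 / (m * t0))-lipschitz_on UNIV F"
    proof (rule lipschitz_onI)
      fix x y show "dist (F x) (F y) \<le> 1 / (m * t0) * dist x y"
        using lipF[of x y] lipF[of y x] monoF[of x y] monoF[of y x]
        by (cases "x \<le> y") (auto simp: dist_real_def)
    qed (use m t0 in auto)
    then show ?thesis using lipschitz_on_continuous_on continuous_on_eq_continuous_at by blast
  qed
  have botF: "(F \<longlongrightarrow> 0) at_bot"
    using \<psi>(6) by (intro tendsto_eventually) (auto simp: eventually_at_bot_linorder F_def)
  have topF: "(F \<longlongrightarrow> 1) at_top"
    using \<psi>(7) t0 by (intro tendsto_eventually) (auto simp: eventually_at_top_linorder F_def)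
  have rcF: "continuous (at_right a) F" for a using contF continuous_at_imp_continuous_at_within by blast
  define M where "M = interval_measure F"
  interpret M: real_distribution M
    unfolding M_def by (rule real_distribution_interval_measure) (use monoF rcF botF topF in auto)
  have cdfM: "cdf M = F"
    unfolding cdf_def M_def using measure_interval_measure_Iic[OF monoF rcF botF] by auto
  have "absolutely_continuous lborel M"
    by (rule lipschitz_cdf_imp_absolutely_continuous[OF M.real_distribution_axioms, of "1 / (m * t0)"])
       (use lipF cdfM in auto)
  then obtain g where g: "g \<in> borel_measurable borel" "\<And>x. 0 \<le> g x" "M = density lborel g"
    "AE x in lborel. (cdf M has_real_derivative g x) (at x)"
    using absolutely_continuous_cdf_derivative[of M] M.finite_measure_axioms by auto
  note [measurable] = g(1)
  obtain N where N: "N \<in> null_sets lborel" "\<And>x. x \<notin> N \<Longrightarrow> (F has_real_derivative g x) (at x)"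
    using AE_E3[OF g(4)] cdfM by (auto simp: null_sets_def)
  have [measurable]: "N \<in> sets borel" using N by (auto simp: null_sets_def)
  define E where "E = {w. \<phi> 0 < w \<and> w < \<phi> t0 \<and> w \<notin> N \<and> 1 / (c * t0) < g w}"
  have E[measurable]: "E \<in> sets borel" unfolding E_def by measurable
  show ?thesis
  proof (rule that[OF E])
    fix w assume w: "w \<in> E"
    then have der: "(F has_real_derivative g w) (at w)" and gw: "1 / (c * t0) < g w" using N by (auto simp: E_def)
    have gpos: "g w > 0" using gw c' t0 by (meson less_trans zero_less_divide_1_iff mult_pos_pos)
    define s where "s = \<psi> w"
    have s: "0 \<le> s" "s \<le> t0" using \<psi> by (auto simp: s_def)
    have Fs: "F (\<phi> s) = F w" using \<psi>(5)[OF s] by (simp add: F_def s_def)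
    have "\<phi> s = w"
    proof (rule ccontr)
      assume "\<phi> s \<noteq> w"
      then consider "\<phi> s < w" | "w < \<phi> s" by linarith
      then have "g w = 0"
      proof cases
        case 1 then show ?thesis
          using mono_const_interval_derivative[of F "\<phi> s" w "g w" w] monoF Fs der by (auto intro: monoI)
      next
        case 2 then show ?thesis
          using mono_const_interval_derivative[of F w "\<phi> s" "g w" w] monoF Fs der by (auto intro: monoI)
      qed
      then show False using gpos by simp
    qed
    moreover have "s < t0" using calculation w s by (cases "s = t0") (auto simp: E_def)
    moreover have "\<forall>\<^sub>F \<epsilon> in at_right 0. \<phi> (s + \<epsilon>) - \<phi> s \<le> c * \<epsilon>"
    proof -
      have "\<exists>d>0. \<forall>h. h \<noteq> 0 \<and> norm (h - 0) < d \<longrightarrow> norm ((F (w + h) - F w) / h - g w) < g w - 1 / (c * t0)"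
        using der gw unfolding DERIV_def LIM_eq by (simp only: diff_gt_0_iff_gt)
      then obtain d where d: "d > 0"
        "\<And>h. 0 < h \<Longrightarrow> h < d \<Longrightarrow> \<bar>(F (w + h) - F w) / h - g w\<bar> < g w - 1 / (c * t0)"
        by auto
      have ps: "h < c * (\<psi> (w + h) - s)" if "0 < h" "h < d" for h
      proof -
        have "1 / (c * t0) < (F (w + h) - F w) / h" using d(2)[OF that] by linarith
        then have "1 / (c * t0) * h < F (w + h) - F w" using that by (simp add: pos_less_divide_eq)
        then show ?thesis using c' t0 that by (simp add: F_def s_def field_simps)
      qed
      have "\<forall>\<^sub>F \<epsilon> in at_right 0. \<epsilon> < d / (2 * c) \<and> \<epsilon> < t0 - s \<and> 0 < \<epsilon>"
        using d c' \<open>s < t0\<close> by (auto intro!: eventually_conj eventually_at_right_less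
          order_tendstoD(2)[of "\<lambda>x. x", OF tendsto_ident_at])
      then show ?thesis
      proof eventually_elim
        case (elim \<epsilon>)
        have inv: "\<psi> (\<phi> (s + \<epsilon>)) = s + \<epsilon>" using elim s by (intro \<psi>(5)) auto
        define h where "h = \<phi> (s + \<epsilon>) - w"
        have "h < d"
        proof (rule ccontr)
          assume "\<not> h < d"
          then have "\<psi> (w + d / 2) \<le> \<psi> (\<phi> (s + \<epsilon>))"
            using d by (intro monoD[OF \<psi>(1)]) (auto simp: h_def)
          then have "c * (\<psi> (w + d / 2) - s) \<le> c * \<epsilon>"
            using inv c' by (intro mult_left_mono) auto
          then have "d / 2 < c * \<epsilon>" using ps[of "d / 2"] d by simp
          then show False using elim c' by (simp add: field_simps)
        qed
        have "h \<le> c * \<epsilon>"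
        proof (cases "h > 0")
          case True
          then have "h < c * (\<psi> (w + h) - s)" using ps \<open>h < d\<close> by blast
          also have "\<psi> (w + h) - s = \<epsilon>" using inv by (simp add: h_def)
          finally show ?thesis by simp
        next
          case False
          moreover have "0 \<le> c * \<epsilon>" using c' elim by simp
          ultimately show ?thesis by linarith
        qed
        then show ?case using \<open>\<phi> s = w\<close> by (simp add: h_def)
      qed
    qed
    ultimately show "\<exists>s. 0 \<le> s \<and> s < t0 \<and> \<phi> s = w \<and> (\<forall>\<^sub>F \<epsilon> in at_right 0. \<phi> (s + \<epsilon>) - \<phi> s \<le> c * \<epsilon>)"
      using s by blast
  next
    fix t assume t: "0 < t" "t \<le> t0"
    define B where "B = {\<phi> 0<..\<phi> t}"
    have Bsub: "\<phi> t \<le> \<phi> 0 + c' * t" using slow t by simp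
    have phi_mono: "\<phi> x \<le> \<phi> y" if "0 \<le> x" "x \<le> y" "y \<le> t0" for x y
    proof -
      have "0 \<le> m * (y - x)" using m that by simp
      then show ?thesis using steep[OF that] by linarith
    qed
    have phit: "\<phi> t \<le> \<phi> t0" and phi0: "\<phi> 0 \<le> \<phi> t" using t by (auto intro!: phi_mono)
    have gle: "g x \<le> 1 / (m * t0)" if "x \<notin> N" for x
    proof (rule tendsto_upperbound)
      show "((\<lambda>h. (F (x + h) - F x) / h) \<longlongrightarrow> g x) (at_right 0)"
        using N(2)[OF that] unfolding DERIV_def
        by (rule tendsto_mono[OF at_le, rotated]) simp
      show "\<forall>\<^sub>F h in at_right 0. (F (x + h) - F x) / h \<le> 1 / (m * t0)"
        using eventually_at_right_less[of 0]
      proof eventually_elim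
        case (elim h) then show ?case using lipF[of x "x+h"] by (simp add: pos_divide_le_eq)
      qed
    qed simp
    have "ennreal (t / t0) = emeasure M B"
    proof -
      have "emeasure M B = ennreal (F (\<phi> t) - F (\<phi> 0))"
        unfolding B_def M_def using phi0 by (intro emeasure_interval_measure_Ioc monoF rcF) auto
      then show ?thesis using \<psi>(5)[of t] \<psi>(5)[of 0] t t0 by (simp add: F_def)
    qed
    also have "\<dots> = (\<integral>\<^sup>+x. ennreal (g x) * indicator B x \<partial>lborel)"
      by (subst g(3), subst emeasure_density) (auto simp: B_def)
    also have "\<dots> \<le> (\<integral>\<^sup>+x. ennreal (1 / (m * t0)) * indicator (E \<inter> B) x + ennreal (1 / (c * t0)) * indicator B x \<partial>lborel)"
    proof (rule nn_integral_mono_AE)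
      have "AE x in lborel. x \<notin> N" using N(1) by (rule AE_not_in)
      moreover have "AE x in lborel. x \<noteq> \<phi> t" by (rule AE_lborel_singleton)
      ultimately show "AE x in lborel. ennreal (g x) * indicator B x \<le>
         ennreal (1 / (m * t0)) * indicator (E \<inter> B) x + ennreal (1 / (c * t0)) * indicator B x"
      proof eventually_elim
        case (elim x)
        show ?case
        proof (cases "x \<in> B")
          case True
          show ?thesis
          proof (cases "x \<in> E")
            case True
            then show ?thesis using gle[OF elim(1)] \<open>x \<in> B\<close>
              by (auto intro: order_trans[OF ennreal_leI] simp: add_increasing2)
          next
            case False
            then have "g x \<le> 1 / (c * t0)" using elim \<open>x \<in> B\<close> phit by (auto simp: E_def B_def)
            then show ?thesis using \<open>x \<in> B\<close> False by (auto intro: ennreal_leI)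
          qed
        qed simp
      qed
    qed
    also have "\<dots> = ennreal (1 / (m * t0)) * emeasure lborel (E \<inter> B) + ennreal (1 / (c * t0)) * emeasure lborel B"
      by (subst nn_integral_add) (auto simp: B_def nn_integral_cmult_indicator)
    also have "emeasure lborel (E \<inter> B) = ennreal (measure lborel (E \<inter> B))"
    proof (rule emeasure_eq_ennreal_measure)
      have "emeasure lborel (E \<inter> B) \<le> emeasure lborel B" by (intro emeasure_mono) (auto simp: B_def)
      also have "\<dots> < top" using phi0 by (simp add: B_def)
      finally show "emeasure lborel (E \<inter> B) \<noteq> top" by simp
    qed
    also have "emeasure lborel B = ennreal (\<phi> t - \<phi> 0)" using phi0 by (simp add: B_def)
    also have "ennreal (1 / (m * t0)) * ennreal (measure lborel (E \<inter> B)) + ennreal (1 / (c * t0)) * ennreal (\<phi> t - \<phi> 0)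
       = ennreal (1 / (m * t0) * measure lborel (E \<inter> B) + 1 / (c * t0) * (\<phi> t - \<phi> 0))"
    proof -
      have "0 \<le> 1 / (m * t0)" "0 \<le> 1 / (c * t0)" "0 \<le> \<phi> t - \<phi> 0" using m t0 c' phi0 by auto
      then show ?thesis
        by (metis (no_types, lifting) ennreal_mult ennreal_plus measure_nonneg mult_nonneg_nonneg)
    qed
    finally have "t / t0 \<le> 1 / (m * t0) * measure lborel (E \<inter> B) + 1 / (c * t0) * (\<phi> t - \<phi> 0)"
      using m t0 c' phi0 by (subst (asm) ennreal_le_iff) auto
    then have "t0 * (t / t0) \<le> t0 * (1 / (m * t0) * measure lborel (E \<inter> B) + 1 / (c * t0) * (\<phi> t - \<phi> 0))"
      using t0 by (intro mult_left_mono) auto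
    then have "t \<le> measure lborel (E \<inter> B) / m + (\<phi> t - \<phi> 0) / c"
      using m t0 c' by (simp add: distrib_left)
    also have "(\<phi> t - \<phi> 0) / c \<le> c' * t / c" using Bsub c' by (intro divide_right_mono) auto
    finally have "m * (1 - c' / c) * t \<le> measure lborel (E \<inter> B)"
      using m by (simp add: field_simps)
    also have "\<dots> \<le> measure lborel (E \<inter> {\<phi> 0<..\<phi> 0 + c' * t})"
    proof (rule measure_mono_fmeasurable)
      have "{\<phi> 0<..\<phi> 0 + c' * t} \<in> fmeasurable lborel"
        using emeasure_bounded_finite[of "{\<phi> 0<..\<phi> 0 + c' * t}"] by (intro fmeasurableI) (auto simp: bounded_Ioc)
      then show "E \<inter> {\<phi> 0<..\<phi> 0 + c' * t} \<in> fmeasurable lborel"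
        by (rule fmeasurable_Int_fmeasurable[of _ lborel E, simplified Int_commute]) auto
    qed (use Bsub in \<open>auto simp: B_def\<close>)
    finally show "m * (1 - c' / c) * t \<le> measure lborel (E \<inter> {\<phi> 0<..\<phi> 0 + c' * t})" .
  qed
qed

section \<open>Measurability from one-sided density\<close>

text \<open>
  A Borel subset of maximal measure, up to null sets: the union of a sequence of Borel subsets
  whose measures approach the supremum.
\<close>

lemma measurable_kernel:
  fixes S :: "real set"
  assumes "S \<subseteq> {a..b}"
  obtains K where "K \<in> sets borel" "K \<subseteq> S" "\<And>E. E \<in> sets borel \<Longrightarrow> E \<subseteq> S \<Longrightarrow> E - K \<in> null_sets lborel"
proof -
  define \<E> where "\<E> = {E \<in> sets borel. E \<subseteq> S}"
  have fm: "E \<in> fmeasurable lborel" if "E \<in> \<E>" for E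
    using that assms emeasure_bounded_finite[of E] bounded_subset[OF bounded_closed_interval, of E a b]
    by (intro fmeasurableI) (auto simp: \<E>_def)
  have bdd: "bdd_above (measure lborel ` \<E>)"
  proof (rule bdd_aboveI2)
    fix E assume E: "E \<in> \<E>"
    show "measure lborel E \<le> measure lborel {a..b}"
      using E assms fmeasurable_cbox[of a b] by (intro measure_mono_fmeasurable) (auto simp: \<E>_def fmeasurable_def)
  qed
  have ne: "measure lborel ` \<E> \<noteq> {}" by (auto simp: \<E>_def)
  define s where "s = Sup (measure lborel ` \<E>)"
  have "\<exists>E\<in>\<E>. s - 1 / real (Suc n) < measure lborel E" for n
    using less_cSup_iff[OF ne bdd, of "s - 1 / real (Suc n)"] by (auto simp: s_def)
  then obtain E where E: "\<And>n. E n \<in> \<E>" "\<And>n. s - 1 / real (Suc n) < measure lborel (E n)" by metis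
  define K where "K = (\<Union>n. E n)"
  have K: "K \<in> \<E>" using E(1) by (auto simp: K_def \<E>_def)
  have sK: "s \<le> measure lborel K"
  proof (rule field_le_epsilon)
    fix e :: real assume "0 < e"
    then obtain n where "1 / real (Suc n) < e" using nat_approx_posE by blast
    moreover have "measure lborel (E n) \<le> measure lborel K"
      using fm K E(1)[of n] by (intro measure_mono_fmeasurable) (auto simp: K_def \<E>_def)
    ultimately show "s \<le> measure lborel K + e" using E(2)[of n] by linarith
  qed
  show ?thesis
  proof (rule that[of K])
    fix D assume D: "D \<in> sets borel" "D \<subseteq> S"
    then have U: "K \<union> D \<in> \<E>" "D - K \<in> \<E>" using K by (auto simp: \<E>_def)
    have "measure lborel K + measure lborel (D - K) = measure lborel (K \<union> D)"
      using fm[OF U(2)] fm[OF K] by (subst measure_Un_AE[symmetric, OF AE_I2]) (auto intro!: arg_cong[where f="measure lborel"])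
    also have "\<dots> \<le> s" unfolding s_def using U bdd by (intro cSup_upper) auto
    finally have "measure lborel (D - K) = 0" using sK measure_nonneg[of lborel "D - K"] by linarith
    then have "emeasure lborel (D - K) = 0" by (subst emeasure_eq_measure2[OF fm[OF U(2)]]) simp
    then show "D - K \<in> null_sets lborel" using D K by (auto simp: null_sets_def \<E>_def)
  qed (use K in \<open>auto simp: \<E>_def\<close>)
qed

text \<open>
  Let \<open>K\<close> be the measurable kernel of \<open>S\<close>. By the density theorem \<open>K\<close> has density 0 at almost every
  point outside \<open>K\<close>. Each set \<open>E\<close> is contained in \<open>K\<close> up to a null set, so at a point of \<open>S - K\<close> the density
  would be positive. Hence \<open>S - K\<close> is a null set.
\<close>

theorem right_density_imp_lebesgue_measurable:
  fixes S :: "real set"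
  assumes S: "S \<subseteq> {a..b}"
    and dens: "\<And>x. x \<in> S \<Longrightarrow> \<exists>E\<in>sets borel. E \<subseteq> S \<and> (\<exists>\<eta>>0. \<forall>\<^sub>F \<delta> in at_right 0. \<eta> * \<delta> \<le> measure lborel (E \<inter> {x<..x+\<delta>}))"
  shows "S \<in> sets lebesgue"
proof -
  obtain K where K: "K \<in> sets borel" "K \<subseteq> S" "\<And>E. E \<in> sets borel \<Longrightarrow> E \<subseteq> S \<Longrightarrow> E - K \<in> null_sets lborel"
    by (rule measurable_kernel[OF S]) (rule that)
  note [measurable] = K(1)
  have fm: "K \<in> fmeasurable lborel"
    using K assms emeasure_bounded_finite[of K] bounded_subset[OF bounded_closed_interval, of K a b]
    by (intro fmeasurableI) auto
  define M where "M = density lborel (indicator K :: real \<Rightarrow> real)"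
  have "AE x in lborel. (cdf M has_real_derivative indicator K x) (at x)"
    unfolding M_def using fm by (intro cdf_density_derivative) (auto simp: fmeasurable_def integrable_indicator_iff)
  then have "AE x in lborel. x \<notin> S - K"
  proof eventually_elim
    case (elim x)
    show "x \<notin> S - K"
    proof
      assume x: "x \<in> S - K"
      then obtain E \<eta> where E: "E \<in> sets borel" "E \<subseteq> S" "\<eta> > 0"
        "\<forall>\<^sub>F \<delta> in at_right 0. \<eta> * \<delta> \<le> measure lborel (E \<inter> {x<..x+\<delta>})"
        using dens[of x] by blast
      have incr: "measure lborel (E \<inter> {x<..x+\<delta>}) \<le> cdf M (x + \<delta>) - cdf M x" if "0 < \<delta>" for \<delta>
      proof -
        have emM: "emeasure M B = emeasure lborel (K \<inter> B)" if "B \<in> sets borel" for B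
          unfolding M_def using that K(1) by (subst emeasure_density)
            (auto simp: ennreal_indicator indicator_inter_arith[symmetric] )
        have mM: "measure M B = measure lborel (K \<inter> B)" if "B \<in> sets borel" for B
          using emM[OF that] by (simp add: measure_def)
        have fmK: "K \<inter> B \<in> fmeasurable lborel" if "B \<in> sets borel" for B
          using fm that by (intro fmeasurable_Int_fmeasurable) auto
        have "cdf M (x + \<delta>) = measure lborel (K \<inter> {..x}) + measure lborel (K \<inter> {x<..x+\<delta>})"
        proof -
          have "K \<inter> {..x + \<delta>} = (K \<inter> {..x}) \<union> (K \<inter> {x<..x+\<delta>})" using that by auto
          then show ?thesis
            unfolding cdf_def mM[OF borel_closed[OF closed_atMost]]
            by (simp add: measure_Un_AE[OF AE_I2] fmK disjoint_iff)
        qed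
        moreover have "measure lborel (E \<inter> {x<..x+\<delta>}) \<le> measure lborel (K \<inter> {x<..x+\<delta>})"
        proof -
          have "measure lborel (E \<inter> {x<..x+\<delta>}) \<le> measure lborel (K \<inter> {x<..x+\<delta>} \<union> (E - K))"
          proof (rule measure_mono_fmeasurable)
            show "K \<inter> {x<..x+\<delta>} \<union> (E - K) \<in> fmeasurable lborel"
              using K(3)[OF E(1,2)] fmK[of "{x<..x+\<delta>}"] by (intro fmeasurable.Un) (auto simp: fmeasurable_def)
          qed (use E in auto)
          also have "\<dots> = measure lborel (K \<inter> {x<..x+\<delta>})"
            using K(3)[OF E(1,2)] fmK[of "{x<..x+\<delta>}"] by (intro measure_Un_null_set) (auto simp: fmeasurable_def)
          finally show ?thesis .
        qed
        ultimately show ?thesis using mM by (simp add: cdf_def)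
      qed
      have "(cdf M has_real_derivative 0) (at x)" using elim x by simp
      then have "((\<lambda>h. (cdf M (x + h) - cdf M x) / h) \<longlongrightarrow> 0) (at_right 0)"
        unfolding DERIV_def by (rule tendsto_mono[OF at_le, rotated]) simp
      moreover have "\<forall>\<^sub>F h in at_right 0. \<eta> \<le> (cdf M (x + h) - cdf M x) / h"
        using E(4) eventually_at_right_less[of 0]
        by eventually_elim (use incr in \<open>force simp: pos_le_divide_eq\<close>)
      ultimately have "\<eta> \<le> 0" by (rule tendsto_lowerbound) simp
      then show False using \<open>\<eta> > 0\<close> by simp
    qed
  qed
  then obtain N where "{x \<in> space lborel. \<not> x \<notin> S - K} \<subseteq> N" "N \<in> null_sets lborel"
    by (auto elim!: AE_E simp: null_sets_def)
  then have "S - K \<in> null_sets lebesgue"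
    by (intro null_sets_completion_subset[of "S - K" N] null_sets_completionI) auto
  then have "K \<union> (S - K) \<in> sets lebesgue" using K(1) by (intro sets.Un) auto
  moreover have "K \<union> (S - K) = S" using K(2) by auto
  ultimately show ?thesis by simp
qed

section \<open>The isoperimetric profile of a metric probability space\<close>

lemma open_nbhd_open [simp]: "open (open_nbhd \<epsilon> A)"
  by (auto simp: open_nbhd_def)

lemma subset_open_nbhd: "0 < \<epsilon> \<Longrightarrow> A \<subseteq> open_nbhd \<epsilon> A"
  by (force simp: open_nbhd_def)

lemma open_nbhd_mono: "\<epsilon> \<le> \<delta> \<Longrightarrow> A \<subseteq> B \<Longrightarrow> open_nbhd \<epsilon> A \<subseteq> open_nbhd \<delta> B"
  by (auto simp: open_nbhd_def)

lemma open_nbhd_open_nbhd: "open_nbhd \<epsilon> (open_nbhd \<delta> A) \<subseteq> open_nbhd (\<delta> + \<epsilon>) A"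
proof
  fix z assume "z \<in> open_nbhd \<epsilon> (open_nbhd \<delta> A)"
  then obtain x y where "x \<in> A" "dist x y < \<delta>" "dist y z < \<epsilon>" by (auto simp: open_nbhd_def)
  moreover have "dist x z \<le> dist x y + dist y z" by (rule dist_triangle)
  ultimately show "z \<in> open_nbhd (\<delta> + \<epsilon>) A" by (auto simp: open_nbhd_def intro!: bexI[of _ x])
qed

locale borel_prob_space = prob_space \<mu> for \<mu> :: "'a::metric_space measure" +
  assumes sets_borel [measurable_cong, simp]: "sets \<mu> = sets borel"
begin

lemma space_UNIV [simp]: "space \<mu> = UNIV"
  using sets_borel by (metis sets_eq_imp_space_eq space_borel)

lemma boundary_measure_nonneg:
  assumes "A \<in> sets borel"
  shows "0 \<le> boundary_measure \<mu> A"
  unfolding boundary_measure_def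
proof (rule le_Limsup)
  show "\<forall>\<^sub>F \<epsilon> in at_right 0. 0 \<le> ereal ((prob (open_nbhd \<epsilon> A) - prob A) / \<epsilon>)"
    using eventually_at_right_less[of 0]
  proof eventually_elim
    case (elim \<epsilon>)
    then have "prob A \<le> prob (open_nbhd \<epsilon> A)" using assms by (intro finite_measure_mono subset_open_nbhd) auto
    then show ?case using elim by simp
  qed
qed simp

lemma isoperimetric_profile_nonneg: "0 \<le> isoperimetric_profile \<mu> v"
  unfolding isoperimetric_profile_def by (intro INF_greatest) (auto intro: boundary_measure_nonneg)

lemma isoperimetric_profile_0: "isoperimetric_profile \<mu> 0 = 0"
proof (rule antisym[OF _ isoperimetric_profile_nonneg])
  have "boundary_measure \<mu> {} = 0"
    unfolding boundary_measure_def by (simp add: open_nbhd_def Limsup_const)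
  then show "isoperimetric_profile \<mu> 0 \<le> 0"
    unfolding isoperimetric_profile_def by (intro INF_lower2[of "{}"]) auto
qed

lemma isoperimetric_profile_1: "isoperimetric_profile \<mu> 1 = 0"
proof (rule antisym[OF _ isoperimetric_profile_nonneg])
  have "boundary_measure \<mu> UNIV = Limsup (at_right 0) (\<lambda>\<epsilon>::real. 0 :: ereal)"
    unfolding boundary_measure_def
  proof (rule Limsup_eq)
    show "\<forall>\<^sub>F \<epsilon> in at_right 0. ereal ((prob (open_nbhd \<epsilon> UNIV) - prob UNIV) / \<epsilon>) = 0"
      using eventually_at_right_less[of 0]
    proof eventually_elim
      case (elim \<epsilon>)
      then have "open_nbhd \<epsilon> UNIV = (UNIV :: 'a set)" using subset_open_nbhd[of \<epsilon> UNIV] by auto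
      then show ?case by (simp add: zero_ereal_def)
    qed
  qed
  also have "\<dots> = 0" by (simp add: Limsup_const)
  finally have "boundary_measure \<mu> UNIV = 0" .
  then show "isoperimetric_profile \<mu> 1 \<le> 0"
    unfolding isoperimetric_profile_def using prob_space by (intro INF_lower2[of UNIV]) auto
qed

lemma boundary_measure_leI:
  assumes "\<forall>\<^sub>F \<epsilon> in at_right 0. prob (open_nbhd \<epsilon> A) - prob A \<le> c * \<epsilon>"
  shows "boundary_measure \<mu> A \<le> ereal c"
  unfolding boundary_measure_def
proof (rule Limsup_bounded)
  show "\<forall>\<^sub>F \<epsilon> in at_right 0. ereal ((prob (open_nbhd \<epsilon> A) - prob A) / \<epsilon>) \<le> ereal c"
    using assms eventually_at_right_less[of 0]
    by eventually_elim (simp add: pos_divide_le_eq)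
qed

lemma boundary_measure_lessD:
  assumes "boundary_measure \<mu> A < ereal c"
  shows "\<forall>\<^sub>F \<epsilon> in at_right 0. prob (open_nbhd \<epsilon> A) - prob A < c * \<epsilon>"
  using Limsup_lessD[OF assms[unfolded boundary_measure_def]] eventually_at_right_less[of 0]
  by eventually_elim (simp add: pos_divide_less_eq)

text \<open>
  An upper limit exceeding \<open>c\<close> only yields arbitrarily small \<open>\<epsilon>\<close> with a difference quotient above \<open>c\<close>,
  not all small \<open>\<epsilon>\<close>. For the growth of measures of neighbourhoods this suffices, by \<open>mono_frequently_steep_imp_steep\<close>.
\<close>

lemma boundary_measure_gtD:
  assumes "ereal c < boundary_measure \<mu> A"
  shows "\<exists>\<^sub>F \<epsilon> in at_right 0. c * \<epsilon> \<le> prob (open_nbhd \<epsilon> A) - prob A"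
proof (rule ccontr)
  assume "\<not> ?thesis"
  then have "\<forall>\<^sub>F \<epsilon> in at_right 0. prob (open_nbhd \<epsilon> A) - prob A \<le> c * \<epsilon>"
    by (auto simp: not_frequently elim: eventually_mono)
  from boundary_measure_leI[OF this] assms show False by simp
qed

lemma cheeger_inequality:
  assumes "ereal h < cheeger_constant \<mu>" "A \<in> sets borel" "0 < prob A" "prob A < 1"
  shows "ereal (h * min (prob A) (1 - prob A)) < boundary_measure \<mu> A"
proof -
  define k where "k = min (prob A) (1 - prob A)"
  have k: "0 < k" using assms by (simp add: k_def)
  have "prob (- A) = 1 - prob A" using prob_compl[of A] assms by (simp add: Compl_eq_Diff_UNIV)
  then have "cheeger_constant \<mu> \<le> boundary_measure \<mu> A / ereal k"
    unfolding cheeger_constant_def k_def using assms by (intro INF_lower2[of A]) auto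
  with assms(1) have "ereal h < boundary_measure \<mu> A / ereal k" by (rule less_le_trans)
  then show ?thesis using k unfolding k_def[symmetric]
    by (cases "boundary_measure \<mu> A") (auto simp: pos_less_divide_eq split: if_splits)
qed

lemma isoperimetric_profile_lower_bound:
  assumes "ereal h < cheeger_constant \<mu>" "0 < v" "v < 1"
  shows "ereal (h * min v (1 - v)) \<le> isoperimetric_profile \<mu> v"
  unfolding isoperimetric_profile_def
  by (intro INF_greatest) (use cheeger_inequality[OF assms(1)] assms in \<open>force intro: less_imp_le\<close>)

text \<open>
  The growth function \<open>\<phi> t = \<mu> (U\<^sub>t A)\<close> of a set \<open>A\<close> with \<open>\<mu> A = v\<close> and boundary measure below \<open>c\<close> is slow by
  the choice of \<open>A\<close> and steep by the Cheeger inequality for the neighbourhoods of \<open>A\<close>.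
\<close>

theorem profile_sublevel_right_density:
  assumes h: "0 < h" "ereal h < cheeger_constant \<mu>"
    and v: "0 < v" "v < 1" "isoperimetric_profile \<mu> v < ereal c"
  shows "\<exists>E\<in>sets borel. E \<subseteq> {w. 0 < w \<and> w < 1 \<and> isoperimetric_profile \<mu> w < ereal c} \<and>
    (\<exists>\<eta>>0. \<forall>\<^sub>F \<delta> in at_right 0. \<eta> * \<delta> \<le> measure lborel (E \<inter> {v<..v+\<delta>}))"
proof -
  obtain A where A: "A \<in> sets borel" "prob A = v" "boundary_measure \<mu> A < ereal c"
    using v(3) unfolding isoperimetric_profile_def by (auto simp: INF_less_iff)
  obtain c2 where c2: "boundary_measure \<mu> A < ereal c2" "c2 < c" using A(3) ereal_dense2 by force
  \<comment> \<open>The gap between \<open>c1\<close> and \<open>c2\<close> gives the slow values a positive proportion; the gap between \<open>c2\<close> and \<open>c\<close> makes the inequality for the profile strict.\<close>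
  obtain c1 where c1: "boundary_measure \<mu> A < ereal c1" "c1 < c2" using c2(1) ereal_dense2 by force
  have "0 \<le> boundary_measure \<mu> A" using A by (intro boundary_measure_nonneg)
  then have c1_pos: "0 < c1" using c1(1) by (metis ereal_less(2) le_less_trans)
  obtain e0 where e0: "0 < e0" "\<And>\<epsilon>. 0 < \<epsilon> \<Longrightarrow> \<epsilon> < e0 \<Longrightarrow> prob (open_nbhd \<epsilon> A) - prob A < c1 * \<epsilon>"
    using boundary_measure_lessD[OF c1(1)] unfolding eventually_at_right_field by auto
  \<comment> \<open>The open neighbourhood of radius 0 is empty, so time 0 is treated separately.\<close>
  define U where "U t = (if t = 0 then A else open_nbhd t A)" for t
  define \<phi> where "\<phi> t = prob (U t)" for t
  \<comment> \<open>Up to time \<open>t0\<close> the measure of \<open>U t\<close> stays between \<open>v\<close> and \<open>(1 + v) / 2\<close>, away from 0 and 1.\<close>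
  define t0 where "t0 = min (e0 / 2) ((1 - v) / (2 * c1))"
  define m where "m = h * min v ((1 - v) / 2)"
  have t0: "0 < t0" "t0 < e0" using e0 v c1_pos by (auto simp: t0_def)
  have m: "0 < m" using h v by (simp add: m_def)
  have U[simp]: "U t \<in> sets borel" for t using A by (simp add: U_def)
  have UU: "open_nbhd \<epsilon> (U s) \<subseteq> U (s + \<epsilon>)" if "0 \<le> s" "0 < \<epsilon>" for s \<epsilon>
    using that open_nbhd_open_nbhd[of \<epsilon> s A] by (auto simp: U_def)
  have mono: "\<phi> x \<le> \<phi> y" if "0 \<le> x" "x \<le> y" for x y
  proof -
    have "U x \<subseteq> U y" using that open_nbhd_mono[of x y A A] subset_open_nbhd[of y A] by (auto simp: U_def)
    then show ?thesis unfolding \<phi>_def by (intro finite_measure_mono) auto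
  qed
  have \<phi>0: "\<phi> 0 = v" using A by (simp add: \<phi>_def U_def)
  have slow: "\<phi> t \<le> \<phi> 0 + c1 * t" if "0 \<le> t" "t \<le> t0" for t
    using e0(2)[of t] that t0 A(2) by (cases "t = 0") (auto simp: \<phi>_def U_def)
  have range: "v \<le> \<phi> t" "\<phi> t \<le> (1 + v) / 2" if "0 \<le> t" "t \<le> t0" for t
  proof -
    show "v \<le> \<phi> t" using mono[of 0 t] that \<phi>0 by simp
    have "c1 * t \<le> c1 * ((1 - v) / (2 * c1))" using that c1_pos by (intro mult_left_mono) (auto simp: t0_def)
    also have "\<dots> = (1 - v) / 2" using c1_pos by simp
    finally show "\<phi> t \<le> (1 + v) / 2" using slow[OF that] \<phi>0 by argo
  qed
  have step: "\<forall>\<^sub>F \<epsilon> in at_right 0. prob (open_nbhd \<epsilon> (U s)) - prob (U s) \<le> \<phi> (s + \<epsilon>) - \<phi> s" if "0 \<le> s" for s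
    using eventually_at_right_less[of 0]
  proof eventually_elim
    case (elim \<epsilon>)
    have "prob (open_nbhd \<epsilon> (U s)) \<le> prob (U (s + \<epsilon>))" using UU[OF that elim] by (intro finite_measure_mono) auto
    then show ?case by (simp add: \<phi>_def)
  qed
  have freq: "\<exists>\<^sub>F \<epsilon> in at_right 0. m * \<epsilon> \<le> \<phi> (s + \<epsilon>) - \<phi> s" if s: "0 \<le> s" "s < t0" for s
  proof -
    have p: "v \<le> prob (U s)" "prob (U s) \<le> (1 + v) / 2" using range[of s] s by (auto simp: \<phi>_def)
    then have "ereal (h * min (prob (U s)) (1 - prob (U s))) < boundary_measure \<mu> (U s)"
      using v by (intro cheeger_inequality h) auto
    moreover have "m \<le> h * min (prob (U s)) (1 - prob (U s))"
      unfolding m_def using p h by (intro mult_left_mono) (auto simp: min_def field_simps)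
    ultimately have "ereal m < boundary_measure \<mu> (U s)"
      by (meson ereal_less_eq(3) order_le_less_trans)
    from boundary_measure_gtD[OF this] step[OF s(1)] show ?thesis
      by (auto elim!: frequently_rev_mp elim: eventually_mono)
  qed
  have steep: "m * (y - x) \<le> \<phi> y - \<phi> x" if "0 \<le> x" "x \<le> y" "y \<le> t0" for x y
    using mono_frequently_steep_imp_steep[of \<phi> m t0 x y] mono freq m that by auto
  obtain E where E: "E \<in> sets borel"
    "\<And>w. w \<in> E \<Longrightarrow> \<exists>s. 0 \<le> s \<and> s < t0 \<and> \<phi> s = w \<and> (\<forall>\<^sub>F \<epsilon> in at_right 0. \<phi> (s + \<epsilon>) - \<phi> s \<le> c2 * \<epsilon>)"
    "\<And>t. 0 < t \<Longrightarrow> t \<le> t0 \<Longrightarrow> m * (1 - c1 / c2) * t \<le> measure lborel (E \<inter> {\<phi> 0<..\<phi> 0 + c1 * t})"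
    by (rule steep_function_slow_values[OF t0(1) m c1(2) steep slow]) (assumption+, rule that)
  show ?thesis
  proof (intro bexI[of _ E] conjI exI[of _ "m * (1 - c1 / c2) / c1"])
    show "E \<in> sets borel" by fact
    show "E \<subseteq> {w. 0 < w \<and> w < 1 \<and> isoperimetric_profile \<mu> w < ereal c}"
    proof safe
      fix w assume "w \<in> E"
      then obtain s where s: "0 \<le> s" "s < t0" "\<phi> s = w" "\<forall>\<^sub>F \<epsilon> in at_right 0. \<phi> (s + \<epsilon>) - \<phi> s \<le> c2 * \<epsilon>"
        using E(2) by blast
      have "\<forall>\<^sub>F \<epsilon> in at_right 0. prob (open_nbhd \<epsilon> (U s)) - prob (U s) \<le> c2 * \<epsilon>"
        using step[OF s(1)] s(4) by eventually_elim simp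
      then have "boundary_measure \<mu> (U s) \<le> ereal c2" by (rule boundary_measure_leI)
      moreover have "isoperimetric_profile \<mu> w \<le> boundary_measure \<mu> (U s)"
        unfolding isoperimetric_profile_def using s by (intro INF_lower) (auto simp: \<phi>_def)
      ultimately show "isoperimetric_profile \<mu> w < ereal c"
        using c2(2) by (metis ereal_less(2) less_ereal.simps(1) order_le_less_trans order_trans)
      show "0 < w" "w < 1" using range[of s] s v by auto
    qed
    show "0 < m * (1 - c1 / c2) / c1" using m c1 c1_pos by simp
    show "\<forall>\<^sub>F \<delta> in at_right 0. m * (1 - c1 / c2) / c1 * \<delta> \<le> measure lborel (E \<inter> {v<..v + \<delta>})"
      unfolding eventually_at_right_field
    proof (intro exI[of _ "c1 * t0"] conjI allI impI)
      show "0 < c1 * t0" using c1_pos t0 by simp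
      fix \<delta> assume \<delta>: "0 < \<delta>" "\<delta> < c1 * t0"
      have "m * (1 - c1 / c2) * (\<delta> / c1) \<le> measure lborel (E \<inter> {\<phi> 0<..\<phi> 0 + c1 * (\<delta> / c1)})"
        using \<delta> c1_pos by (intro E(3)) (auto simp: field_simps)
      then show "m * (1 - c1 / c2) / c1 * \<delta> \<le> measure lborel (E \<inter> {v<..v + \<delta>})"
        using c1_pos by (simp add: \<phi>0)
    qed
  qed
qed

corollary profile_sublevel_lebesgue_measurable:
  assumes "0 < h" "ereal h < cheeger_constant \<mu>"
  shows "{v. 0 < v \<and> v < 1 \<and> isoperimetric_profile \<mu> v < ereal c} \<in> sets lebesgue"
  by (rule right_density_imp_lebesgue_measurable[of _ 0 1])
     (use profile_sublevel_right_density[OF assms] in auto)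

end

context borel_prob_space
begin

lemma boundary_measure_finiteD:
  assumes "boundary_measure \<mu> A < \<infinity>"
  shows "\<exists>c. \<forall>\<^sub>F \<epsilon> in at_right 0. prob (open_nbhd \<epsilon> A) - prob A \<le> c * \<epsilon>"
proof -
  obtain c where "boundary_measure \<mu> A < ereal c" using less_PInf_Ex_of_nat[of "boundary_measure \<mu> A"] assms by auto
  from boundary_measure_lessD[OF this] show ?thesis by (auto elim!: eventually_mono intro!: exI[of _ c])
qed

lemma boundary_measure_finiteI:
  "\<forall>\<^sub>F \<epsilon> in at_right 0. prob (open_nbhd \<epsilon> A) - prob A \<le> c * \<epsilon> \<Longrightarrow> boundary_measure \<mu> A < \<infinity>"
  using boundary_measure_leI[of A c] by (auto intro: le_less_trans)

text \<open>
  \<open>U\<^sub>\<epsilon> (A \<union> B)\<close> exceeds \<open>A \<union> B\<close> at most by the excesses of \<open>U\<^sub>\<epsilon> A\<close> over \<open>A\<close> and of \<open>U\<^sub>\<epsilon> B\<close> over \<open>B\<close>.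
\<close>

lemma boundary_measure_Un_finite:
  assumes [measurable]: "A \<in> sets borel" "B \<in> sets borel"
    and "boundary_measure \<mu> A < \<infinity>" "boundary_measure \<mu> B < \<infinity>"
  shows "boundary_measure \<mu> (A \<union> B) < \<infinity>"
proof -
  obtain a b where ab: "\<forall>\<^sub>F \<epsilon> in at_right 0. prob (open_nbhd \<epsilon> A) - prob A \<le> a * \<epsilon>"
    "\<forall>\<^sub>F \<epsilon> in at_right 0. prob (open_nbhd \<epsilon> B) - prob B \<le> b * \<epsilon>"
    using boundary_measure_finiteD assms by blast
  have "\<forall>\<^sub>F \<epsilon> in at_right 0. prob (open_nbhd \<epsilon> (A \<union> B)) - prob (A \<union> B) \<le> (a + b) * \<epsilon>"
    using ab eventually_at_right_less[of 0]
  proof eventually_elim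
    case (elim \<epsilon>)
    let ?U = "open_nbhd \<epsilon>"
    have sub: "A \<subseteq> ?U A" "B \<subseteq> ?U B" using elim by (auto intro: subset_open_nbhd[THEN subsetD])
    have [measurable]: "?U A \<in> sets borel" "?U B \<in> sets borel" "?U (A \<union> B) \<in> sets borel" by auto
    have U: "?U (A \<union> B) = ?U A \<union> ?U B" by (auto simp: open_nbhd_def)
    have "prob (?U (A \<union> B)) - prob (A \<union> B) = prob (?U (A \<union> B) - (A \<union> B))"
      using sub U by (subst finite_measure_Diff) auto
    also have "\<dots> \<le> prob ((?U A - A) \<union> (?U B - B))" using U by (intro finite_measure_mono) auto
    also have "\<dots> \<le> prob (?U A - A) + prob (?U B - B)" by (intro measure_Un_le) auto
    also have "\<dots> = (prob (?U A) - prob A) + (prob (?U B) - prob B)" using sub by (simp add: finite_measure_Diff)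
    also have "\<dots> \<le> (a + b) * \<epsilon>" using elim by (simp add: algebra_simps)
    finally show ?case .
  qed
  then show ?thesis by (rule boundary_measure_finiteI)
qed

lemma boundary_measure_UN_finite:
  assumes "finite J" "\<And>i. i \<in> J \<Longrightarrow> A i \<in> sets borel" "\<And>i. i \<in> J \<Longrightarrow> boundary_measure \<mu> (A i) < \<infinity>"
  shows "boundary_measure \<mu> (\<Union>i\<in>J. A i) < \<infinity>"
  using assms
proof (induction J rule: finite_induct)
  case empty
  show ?case by (rule boundary_measure_finiteI[of _ 0]) (simp add: open_nbhd_def)
next
  case (insert j J)
  have "boundary_measure \<mu> (A j \<union> (\<Union>i\<in>J. A i)) < \<infinity>"
    using insert by (intro boundary_measure_Un_finite sets.finite_UN insert.IH) auto
  then show ?case by simp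
qed

end

section \<open>Solution of the autonomous equation\<close>

text \<open>
  The equation \<open>V' t = 1 / q (V t)\<close>. Here \<open>q\<close> stands for \<open>1 / I\<close>, after modification on a null set so that the
  bounds hold at every point of \<open>(0,1)\<close>.
\<close>

locale autonomous_ode =
  fixes q :: "real \<Rightarrow> real" and h :: real
  assumes q_measurable [measurable]: "q \<in> borel_measurable borel"
    and h_pos: "0 < h"
    and q_pos: "\<And>v. 0 < v \<Longrightarrow> v < 1 \<Longrightarrow> 0 < q v"
    and q_le: "\<And>v. 0 < v \<Longrightarrow> v < 1 \<Longrightarrow> q v \<le> 1 / (h * min v (1 - v))"
begin

text \<open>
  The measure \<open>q v dv\<close> of a set of values is the time that a solution spends in it.
\<close>

definition clock :: "real measure" where
  "clock = density lborel (\<lambda>v. indicator {0<..<1} v * ennreal (q v))"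

text \<open>
  The integral of \<open>q\<close> from \<open>1/2\<close> to \<open>v\<close>: the time at which the solution with value \<open>1/2\<close> at time 0 takes the
  value \<open>v\<close>. The value 0 outside \<open>(0,1)\<close> only makes it a Borel function on the line.
\<close>

definition hitting_time :: "real \<Rightarrow> real" where
  "hitting_time v =
     (if v \<in> {0<..<1} then measure clock {1/2<..v} - measure clock {v<..1/2} else 0)"

lemma sets_clock [simp, measurable_cong]: "sets clock = sets borel"
  by (simp add: clock_def)

lemma space_clock [simp]: "space clock = UNIV"
  by (simp add: clock_def)

lemma emeasure_clock:
  "B \<in> sets borel \<Longrightarrow> emeasure clock B = (\<integral>\<^sup>+v. ennreal (q v) * indicator (B \<inter> {0<..<1}) v \<partial>lborel)"
  unfolding clock_def by (subst emeasure_density) (auto intro!: nn_integral_cong split: split_indicator)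

text \<open>
  The Cheeger-type bound on \<open>q\<close> makes the clock finite away from 0 and 1.
\<close>

lemma emeasure_clock_le:
  assumes "0 < x" "x \<le> y" "y < 1"
  shows "emeasure clock {x<..y} \<le> ennreal ((y - x) / (h * min x (1 - y)))"
proof -
  let ?C = "1 / (h * min x (1 - y))"
  have "emeasure clock {x<..y} = (\<integral>\<^sup>+v. ennreal (q v) * indicator ({x<..y} \<inter> {0<..<1}) v \<partial>lborel)"
    by (rule emeasure_clock) simp
  also have "\<dots> \<le> (\<integral>\<^sup>+v. ennreal ?C * indicator {x<..y} v \<partial>lborel)"
  proof (rule nn_integral_mono)
    fix v
    have "q v \<le> ?C" if "v \<in> {x<..y}"
    proof -
      have "q v \<le> 1 / (h * min v (1 - v))" using that assms by (intro q_le) auto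
      also have "\<dots> \<le> ?C" using that assms h_pos
        by (intro divide_left_mono mult_left_mono mult_pos_pos) (auto simp: min_def)
      finally show ?thesis .
    qed
    then show "ennreal (q v) * indicator ({x<..y} \<inter> {0<..<1}) v \<le> ennreal ?C * indicator {x<..y} v"
      by (auto split: split_indicator intro: ennreal_leI)
  qed
  also have "\<dots> = ennreal ?C * ennreal (y - x)"
    using assms by (subst nn_integral_cmult_indicator) auto
  also have "\<dots> = ennreal (?C * (y - x))"
    using assms h_pos by (intro ennreal_mult[symmetric]) auto
  finally show ?thesis by simp
qed

lemma finite_clock:
  assumes "0 < x" "y < 1"
  shows "{x<..y} \<in> fmeasurable clock"
proof (cases "x \<le> y")
  case True
  have "emeasure clock {x<..y} < \<infinity>"
    using emeasure_clock_le[OF assms(1) True assms(2)] by (auto simp: top.not_eq_extremum intro: le_less_trans)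
  then show ?thesis by (intro fmeasurableI) auto
qed simp

lemma clock_pos:
  assumes "0 < x" "x < y" "y < 1"
  shows "0 < emeasure clock {x<..y}"
proof (rule ccontr)
  assume "\<not> ?thesis"
  then have "(\<integral>\<^sup>+v. ennreal (q v) * indicator ({x<..y} \<inter> {0<..<1}) v \<partial>lborel) = 0"
    by (subst emeasure_clock[symmetric]) auto
  then have "AE v in lborel. ennreal (q v) * indicator ({x<..y} \<inter> {0<..<1}) v = 0"
    by (subst (asm) nn_integral_0_iff_AE) auto
  then have "AE v in lborel. v \<notin> {x<..y}"
  proof eventually_elim
    case (elim v)
    show ?case
    proof
      assume "v \<in> {x<..y}"
      then have "v \<in> {x<..y} \<inter> {0<..<1}" "0 < q v" using assms q_pos[of v] by auto
      then show False using elim by simp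
    qed
  qed
  then have "{x<..y} \<in> null_sets lborel" by (subst AE_iff_null_sets) auto
  then have "emeasure lborel {x<..y} = 0" by (rule null_setsD1)
  then show False using assms by simp
qed

lemma measure_clock_diff:
  assumes "0 < x" "x \<le> y" "y < 1"
  shows "measure clock {x<..y} = hitting_time y - hitting_time x"
proof -
  have split: "measure clock {a<..c} = measure clock {a<..b} + measure clock {b<..c}"
    if "0 < a" "a \<le> b" "b \<le> c" "c < 1" for a b c
  proof -
    have "{a<..c} = {a<..b} \<union> {b<..c}" using that by auto
    then show ?thesis using finite_clock[of a b] finite_clock[of b c] that
      by (simp add: measure_Un_AE[OF AE_I2] disjoint_iff)
  qed
  consider "y \<le> 1/2" | "x \<le> 1/2" "1/2 \<le> y" | "1/2 \<le> x" by linarith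
  then show ?thesis
  proof cases
    case 1 then show ?thesis using split[of x y "1/2"] assms by (simp add: hitting_time_def)
  next
    case 2 then show ?thesis using split[of x "1/2" y] assms by (simp add: hitting_time_def)
  next
    case 3 then show ?thesis using split[of "1/2" x y] assms by (simp add: hitting_time_def)
  qed
qed

lemma emeasure_clock_eq:
  assumes "0 < x" "x \<le> y" "y < 1"
  shows "emeasure clock {x<..y} = ennreal (hitting_time y - hitting_time x)"
  using finite_clock[of x y] assms by (simp add: emeasure_eq_measure2 measure_clock_diff)

lemma hitting_time_less:
  assumes "0 < x" "x < y" "y < 1"
  shows "hitting_time x < hitting_time y"
  using clock_pos[OF assms] assms by (simp add: emeasure_clock_eq)

lemma hitting_time_less_iff:
  assumes "x \<in> {0<..<1}" "y \<in> {0<..<1}"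
  shows "hitting_time x < hitting_time y \<longleftrightarrow> x < y"
  using assms hitting_time_less[of x y] hitting_time_less[of y x]
  by (cases x y rule: linorder_cases) auto

lemma hitting_time_le_iff:
  assumes "x \<in> {0<..<1}" "y \<in> {0<..<1}"
  shows "hitting_time x \<le> hitting_time y \<longleftrightarrow> x \<le> y"
  using hitting_time_less_iff[OF assms(2,1)] by linarith

lemma continuous_on_hitting_time: "continuous_on {0<..<1} hitting_time"
proof -
  have "isCont hitting_time v" if v: "v \<in> {0<..<1}" for v
  proof -
    define a b where "a = v / 2" and "b = (1 + v) / 2"
    have ab: "0 < a" "a < v" "v < b" "b < 1" using v by (auto simp: a_def b_def)
    define C where "C = 1 / (h * min a (1 - b))"
    have C: "0 < C" using ab h_pos by (simp add: C_def)
    have *: "\<bar>hitting_time y - hitting_time x\<bar> \<le> C * \<bar>y - x\<bar>" if "x \<in> {a..b}" "y \<in> {a..b}" "x \<le> y" for x y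
    proof -
      have "ennreal (hitting_time y - hitting_time x) \<le> ennreal ((y - x) / (h * min x (1 - y)))"
        using emeasure_clock_le[of x y] emeasure_clock_eq[of x y] that ab by simp
      then have "hitting_time y - hitting_time x \<le> (y - x) / (h * min x (1 - y))"
        using that ab h_pos by (subst (asm) ennreal_le_iff) auto
      also have "\<dots> \<le> (y - x) / (h * min a (1 - b))"
        using that ab h_pos by (intro divide_left_mono mult_left_mono mult_pos_pos) (auto simp: min_def)
      finally have "hitting_time y - hitting_time x \<le> C * (y - x)" by (simp add: C_def)
      moreover have "hitting_time x \<le> hitting_time y" using that ab by (subst hitting_time_le_iff) auto
      ultimately show ?thesis using that by simp
    qed
    have "C-lipschitz_on {a..b} hitting_time"
    proof (rule lipschitz_onI)
      fix x y assume xy: "x \<in> {a..b}" "y \<in> {a..b}"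
      show "dist (hitting_time x) (hitting_time y) \<le> C * dist x y"
        using *[OF xy] *[OF xy(2,1)] by (cases "x \<le> y") (auto simp: dist_real_def abs_minus_commute)
    qed (use C in auto)
    then have "continuous_on {a..b} hitting_time" by (rule lipschitz_on_continuous_on)
    then show ?thesis by (rule continuous_on_interior) (use ab in auto)
  qed
  then show ?thesis by (simp add: continuous_at_imp_continuous_on)
qed

lemma hitting_time_measurable [measurable]: "hitting_time \<in> borel_measurable borel"
proof -
  have "(\<lambda>v. if v \<in> {0<..<1} then hitting_time v else 0) \<in> borel_measurable borel"
    by (rule borel_measurable_continuous_on_if) (auto intro: continuous_on_hitting_time)
  also have "(\<lambda>v. if v \<in> {0<..<1} then hitting_time v else 0) = hitting_time"
    by (auto simp: hitting_time_def)
  finally show ?thesis .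
qed

definition lifetime :: "real set" where
  "lifetime = hitting_time ` {0<..<1}"

lemma hitting_time_IVT:
  assumes "u \<in> {0<..<1}" "v \<in> {0<..<1}" "hitting_time u \<le> t" "t \<le> hitting_time v"
  shows "\<exists>w. u \<le> w \<and> w \<le> v \<and> hitting_time w = t"
proof (rule IVT')
  show "u \<le> v" using assms hitting_time_le_iff[of u v] by auto
  show "continuous_on {u..v} hitting_time"
    using continuous_on_hitting_time by (rule continuous_on_subset) (use assms in auto)
qed (use assms in auto)

lemma is_interval_lifetime: "is_interval lifetime"
  unfolding lifetime_def is_interval_connected_1
  by (intro connected_continuous_image continuous_on_hitting_time) auto

lemma lifetime_measurable [measurable]: "lifetime \<in> sets borel"
  using is_interval_lifetime by (rule real_interval_borel_measurable)

text \<open>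
  The substitution rule for the increasing function \<open>hitting_time\<close>. Both sides are finite
  measures in \<open>B\<close>, so it suffices to compare them on half-lines.
\<close>

lemma clock_hitting_time_interval:
  assumes xy: "0 < x" "x < y" "y < 1" and B: "B \<in> sets borel"
  shows "emeasure clock ({v. hitting_time v \<in> B} \<inter> {x<..y}) =
    emeasure lborel (B \<inter> {hitting_time x<..hitting_time y})"
proof -
  define M where "M = distr (density clock (indicator {x<..y})) borel hitting_time"
  define N where "N = density lborel (indicator {hitting_time x<..hitting_time y})"
  have M: "emeasure M B = emeasure clock ({v. hitting_time v \<in> B} \<inter> {x<..y})" if [measurable]: "B \<in> sets borel" for B
  proof -
    have s: "{v. hitting_time v \<in> B} \<in> sets borel" by measurable
    have "emeasure M B = emeasure (density clock (indicator {x<..y})) {v. hitting_time v \<in> B}"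
      unfolding M_def by (subst emeasure_distr) (auto simp: vimage_def)
    also have "\<dots> = emeasure clock ({v. hitting_time v \<in> B} \<inter> {x<..y})"
      using s by (subst emeasure_density) (auto simp: indicator_inter_arith[symmetric] Int_commute)
    finally show ?thesis .
  qed
  have N: "emeasure N B = emeasure lborel (B \<inter> {hitting_time x<..hitting_time y})" if [measurable]: "B \<in> sets borel" for B
    unfolding N_def by (subst emeasure_density) (auto simp: indicator_inter_arith[symmetric] Int_commute)
  have lt: "hitting_time x < hitting_time y" using hitting_time_less[OF xy] .
  have eq: "emeasure M {t<..} = emeasure N {t<..}" for t
  proof -
    consider "t \<le> hitting_time x" | "hitting_time x \<le> t" "t \<le> hitting_time y" | "hitting_time y < t" by linarith
    then show ?thesis
    proof cases
      case 1
      have "{v. hitting_time v \<in> {t<..}} \<inter> {x<..y} = {x<..y}"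
        using 1 xy hitting_time_less[of x] by force
      moreover have "{t<..} \<inter> {hitting_time x<..hitting_time y} = {hitting_time x<..hitting_time y}" using 1 by auto
      ultimately show ?thesis using lt xy by (simp add: M N emeasure_clock_eq)
    next
      case 2
      then obtain w where w: "x \<le> w" "w \<le> y" "hitting_time w = t" using hitting_time_IVT[of x y t] xy by auto
      have "{v. hitting_time v \<in> {t<..}} \<inter> {x<..y} = {w<..y}"
        using w xy hitting_time_less_iff[of w] by auto
      moreover have "{t<..} \<inter> {hitting_time x<..hitting_time y} = {t<..hitting_time y}" using 2 by auto
      ultimately show ?thesis using 2 w xy by (simp add: M N emeasure_clock_eq)
    next
      case 3
      have "{v. hitting_time v \<in> {t<..}} \<inter> {x<..y} = {}"
      proof -
        have "hitting_time v \<le> hitting_time y" if "v \<in> {x<..y}" for v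
          using that xy by (subst hitting_time_le_iff) auto
        then show ?thesis using 3 by fastforce
      qed
      moreover have "{t<..} \<inter> {hitting_time x<..hitting_time y} = {}" using 3 by auto
      ultimately show ?thesis by (simp add: M N)
    qed
  qed
  have "M = N"
  proof (rule measure_eqI_lessThan)
    fix t
    have "emeasure M {t<..} \<le> emeasure clock {x<..y}" by (subst M) (auto intro!: emeasure_mono)
    also have "\<dots> < \<infinity>" using xy by (simp add: emeasure_clock_eq)
    finally show "emeasure M {t<..} < \<infinity>" .
  qed (auto simp: M_def N_def eq[unfolded M_def N_def])
  then show ?thesis using M[OF B] N[OF B] by simp
qed

text \<open>
  The range of \<open>hitting_time\<close> may be unbounded and the clock infinite, so the substitution rule is
  applied on an increasing sequence of intervals exhausting \<open>(0,1)\<close>.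
\<close>

theorem distr_clock_hitting_time: "distr clock borel hitting_time = density lborel (indicator lifetime)"
proof (rule measure_eqI)
  fix B :: "real set" assume "B \<in> sets (distr clock borel hitting_time)"
  then have [measurable]: "B \<in> sets borel" by simp
  define x y where "x n = 1 / real (n + 3)" and "y n = 1 - 1 / real (n + 3)" for n
  have xy: "0 < x n" "x n < y n" "y n < 1" for n by (auto simp: x_def y_def field_simps)
  have mono: "x m \<le> x n" "y n \<le> y m" if "n \<le> m" for n m using that by (auto simp: x_def y_def frac_le)
  have cover: "\<exists>n. x n < v \<and> v \<le> y n" if v: "0 < v" "v < 1" for v
  proof -
    obtain n where "1 / real (Suc n) < min v (1 - v)" using nat_approx_posE[of "min v (1 - v)"] v by auto
    moreover have "1 / real (n + 3) \<le> 1 / real (Suc n)" by (intro divide_left_mono) auto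
    ultimately show ?thesis by (intro exI[of _ n]) (auto simp: x_def y_def)
  qed
  have s: "{v. hitting_time v \<in> B} \<in> sets borel" by measurable
  have "emeasure (distr clock borel hitting_time) B = emeasure clock {v. hitting_time v \<in> B}"
    by (subst emeasure_distr) (auto simp: vimage_def)
  also have "\<dots> = emeasure clock ({v. hitting_time v \<in> B} \<inter> {0<..<1})"
    using s by (simp add: emeasure_clock Int_assoc)
  also have "{v. hitting_time v \<in> B} \<inter> {0<..<1} = (\<Union>n. {v. hitting_time v \<in> B} \<inter> {x n<..y n})"
    using cover by (auto intro: less_trans[OF xy(1)] le_less_trans[OF _ xy(3)])
  also have "emeasure clock \<dots> = (SUP n. emeasure clock ({v. hitting_time v \<in> B} \<inter> {x n<..y n}))"
  proof (rule SUP_emeasure_incseq[symmetric])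
    show "incseq (\<lambda>n. {v. hitting_time v \<in> B} \<inter> {x n<..y n})"
    proof (rule monoI)
      fix m n :: nat assume "m \<le> n"
      from mono[OF this] show "{v. hitting_time v \<in> B} \<inter> {x m<..y m} \<subseteq> {v. hitting_time v \<in> B} \<inter> {x n<..y n}"
        by auto
    qed
  qed (use s in auto)
  also have "\<dots> = (SUP n. emeasure lborel (B \<inter> {hitting_time (x n)<..hitting_time (y n)}))"
    using xy by (simp add: clock_hitting_time_interval)
  also have "\<dots> = emeasure lborel (\<Union>n. B \<inter> {hitting_time (x n)<..hitting_time (y n)})"
  proof (rule SUP_emeasure_incseq)
    show "incseq (\<lambda>n. B \<inter> {hitting_time (x n)<..hitting_time (y n)})"
    proof (rule monoI)
      fix m n :: nat assume "m \<le> n"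
      from mono[OF this] have "hitting_time (x n) \<le> hitting_time (x m)" "hitting_time (y m) \<le> hitting_time (y n)"
        using xy[of n] xy[of m] by (auto simp: hitting_time_le_iff)
      then show "B \<inter> {hitting_time (x m)<..hitting_time (y m)} \<subseteq> B \<inter> {hitting_time (x n)<..hitting_time (y n)}"
        by auto
    qed
  qed auto
  also have "(\<Union>n. B \<inter> {hitting_time (x n)<..hitting_time (y n)}) = B \<inter> lifetime"
  proof (intro equalityI subsetI)
    fix t assume "t \<in> (\<Union>n. B \<inter> {hitting_time (x n)<..hitting_time (y n)})"
    then obtain n where n: "t \<in> B" "hitting_time (x n) < t" "t \<le> hitting_time (y n)" by auto
    then obtain w where "x n \<le> w" "w \<le> y n" "hitting_time w = t"
      using hitting_time_IVT[of "x n" "y n" t] xy[of n] by auto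
    then show "t \<in> B \<inter> lifetime" using n xy[of n] by (auto simp: lifetime_def)
  next
    fix t assume t: "t \<in> B \<inter> lifetime"
    then obtain v where v: "0 < v" "v < 1" "t = hitting_time v" by (auto simp: lifetime_def)
    obtain n where n: "x n < v" "v \<le> y n" using cover[OF v(1,2)] by blast
    then have "hitting_time (x n) < t" "t \<le> hitting_time (y n)"
      using v xy[of n] by (auto simp: hitting_time_less_iff hitting_time_le_iff)
    then show "t \<in> (\<Union>n. B \<inter> {hitting_time (x n)<..hitting_time (y n)})" using t by auto
  qed
  also have "emeasure lborel (B \<inter> lifetime) = emeasure (density lborel (indicator lifetime)) B"
    by (subst emeasure_density) (auto simp: indicator_inter_arith[symmetric] Int_commute)
  finally show "emeasure (distr clock borel hitting_time) B = emeasure (density lborel (indicator lifetime)) B" .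
qed simp

text \<open>
  On \<open>lifetime\<close> its distribution function is the inverse of \<open>hitting_time\<close>, the solution itself.
\<close>

definition solution_law :: "real measure" where
  "solution_law = distr (restrict_space lborel {0<..<1}) borel hitting_time"

lemma real_distribution_solution_law: "real_distribution solution_law"
proof -
  interpret U: prob_space "restrict_space lborel {0<..<1::real}"
    by (auto simp add: emeasure_restrict_space space_restrict_space intro!: prob_spaceI)
  have "hitting_time \<in> restrict_space lborel {0<..<1} \<rightarrow>\<^sub>M borel" by (intro measurable_restrict_space1) simp
  then show ?thesis unfolding solution_law_def by (rule U.real_distribution_distr)
qed

lemma emeasure_solution_law:
  assumes [measurable]: "B \<in> sets borel"
  shows "emeasure solution_law B = emeasure lborel {v \<in> {0<..<1}. hitting_time v \<in> B}"
  unfolding solution_law_def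
  by (subst emeasure_distr)
     (auto simp: space_restrict_space emeasure_restrict_space intro!: arg_cong[where f="emeasure lborel"] measurable_restrict_space1)

lemma cdf_solution_law:
  assumes "v \<in> {0<..<1}"
  shows "cdf solution_law (hitting_time v) = v"
proof -
  have "{w \<in> {0<..<1}. hitting_time w \<in> {..hitting_time v}} = {0<..v}"
    using assms by (auto simp: hitting_time_le_iff)
  then show ?thesis using assms unfolding cdf_def measure_def by (simp add: emeasure_solution_law)
qed

lemma cdf_solution_law_outside:
  assumes "t \<notin> lifetime"
  shows "cdf solution_law t = 0 \<or> cdf solution_law t = 1"
proof (cases "\<exists>v\<in>{0<..<1}. hitting_time v \<le> t")
  case True
  then obtain u where u: "u \<in> {0<..<1}" "hitting_time u \<le> t" by blast
  have "hitting_time v \<le> t" if "v \<in> {0<..<1}" for v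
    using hitting_time_IVT[OF u(1) that u(2)] u(1) that assms
    by (force simp: lifetime_def image_iff not_le)
  then have "{w \<in> {0<..<1}. hitting_time w \<in> {..t}} = {0<..<1}" by auto
  then have "emeasure solution_law {..t} = emeasure lborel {0<..<1::real}"
    by (subst emeasure_solution_law) (simp, simp only:)
  then show ?thesis by (simp add: cdf_def measure_def)
next
  case False
  then have "{w \<in> {0<..<1}. hitting_time w \<in> {..t}} = {}" by auto
  then have "emeasure solution_law {..t} = 0"
    by (subst emeasure_solution_law) (simp, simp only: emeasure_empty)
  then show ?thesis by (simp add: cdf_def measure_def)
qed

lemma cdf_solution_law_measurable [measurable]: "cdf solution_law \<in> borel_measurable borel"
proof -
  interpret real_distribution solution_law by (rule real_distribution_solution_law)
  show ?thesis by (intro borel_measurable_mono monoI cdf_nondecreasing)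
qed

text \<open>
  The uniform distribution on \<open>(0,1)\<close> has density \<open>1 / q\<close> with respect to the clock, and
  \<open>hitting_time\<close> maps the clock to Lebesgue measure on \<open>lifetime\<close>.
\<close>

lemma solution_law_density:
  "solution_law = density lborel (\<lambda>t. indicator lifetime t * (1 / q (cdf solution_law t)))"
proof (rule measure_eqI)
  show "sets solution_law = sets (density lborel (\<lambda>t. ennreal (indicator lifetime t * (1 / q (cdf solution_law t)))))"
    by (simp add: solution_law_def)
  fix B assume "B \<in> sets solution_law"
  then have [measurable]: "B \<in> sets borel" by (simp add: solution_law_def)
  let ?V = "cdf solution_law"
  have "emeasure (density lborel (\<lambda>t. ennreal (indicator lifetime t * (1 / q (?V t))))) B =
      (\<integral>\<^sup>+t. indicator lifetime t * (ennreal (1 / q (?V t)) * indicator B t) \<partial>lborel)"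
    by (subst emeasure_density) (auto intro!: nn_integral_cong split: split_indicator)
  also have "\<dots> = (\<integral>\<^sup>+t. ennreal (1 / q (?V t)) * indicator B t \<partial>density lborel (indicator lifetime))"
    by (subst nn_integral_density) auto
  also have "\<dots> = (\<integral>\<^sup>+v. ennreal (1 / q (?V (hitting_time v))) * indicator B (hitting_time v) \<partial>clock)"
    unfolding distr_clock_hitting_time[symmetric] by (subst nn_integral_distr) auto
  also have "\<dots> = (\<integral>\<^sup>+v. indicator {v \<in> {0<..<1}. hitting_time v \<in> B} v \<partial>lborel)"
    unfolding clock_def
  proof (subst nn_integral_density)
    show "(\<integral>\<^sup>+v. indicator {0<..<1} v * ennreal (q v) * (ennreal (1 / q (?V (hitting_time v))) * indicator B (hitting_time v)) \<partial>lborel) =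
       (\<integral>\<^sup>+v. indicator {v \<in> {0<..<1}. hitting_time v \<in> B} v \<partial>lborel)"
    proof (rule nn_integral_cong)
      fix v
      have "ennreal (q v) * ennreal (1 / q v) = 1" if "v \<in> {0<..<1}"
        using q_pos[of v] that by (subst ennreal_mult[symmetric]) auto
      then show "indicator {0<..<1} v * ennreal (q v) * (ennreal (1 / q (?V (hitting_time v))) * indicator B (hitting_time v)) =
          indicator {v \<in> {0<..<1}. hitting_time v \<in> B} v"
        by (cases "v \<in> {0<..<1}") (auto simp: cdf_solution_law mult.assoc[symmetric] split: split_indicator)
    qed
  qed auto
  also have "\<dots> = emeasure lborel {v \<in> {0<..<1}. hitting_time v \<in> B}" by (intro nn_integral_indicator) measurable
  finally show "emeasure solution_law B =
      emeasure (density lborel (\<lambda>t. ennreal (indicator lifetime t * (1 / q (?V t))))) B"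
    by (simp add: emeasure_solution_law)
qed

theorem solution_law_derivative:
  "AE t in lborel. (cdf solution_law has_real_derivative indicator lifetime t * (1 / q (cdf solution_law t))) (at t)"
proof -
  interpret real_distribution solution_law by (rule real_distribution_solution_law)
  let ?f = "\<lambda>t. indicator lifetime t * (1 / q (cdf solution_law t))"
  have nonneg: "0 \<le> ?f t" for t
    using q_pos by (auto simp: lifetime_def cdf_solution_law less_imp_le split: split_indicator)
  have "integrable lborel ?f"
  proof (rule integrableI_nonneg)
    have "(\<integral>\<^sup>+t. ennreal (?f t) \<partial>lborel) = emeasure solution_law UNIV"
      by (subst solution_law_density) (simp add: emeasure_density)
    then show "(\<integral>\<^sup>+t. ennreal (?f t) \<partial>lborel) < \<infinity>" by (simp add: less_top[symmetric])
  qed (use nonneg in auto)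
  from cdf_density_derivative[OF this nonneg] show ?thesis
    by (simp only: solution_law_density[symmetric])
qed

text \<open>
  A null set of values has clock measure 0, so the solution takes values in it only during a null set of times.
\<close>

lemma AE_cdf_solution_law:
  assumes "AE v in lborel. P v"
  shows "AE t in lborel. t \<in> lifetime \<longrightarrow> P (cdf solution_law t)"
proof -
  obtain N where N: "N \<in> null_sets lborel" "\<And>v. v \<notin> N \<Longrightarrow> P v" using AE_E3[OF assms] by auto
  have [measurable]: "N \<in> sets borel" using N by auto
  have "emeasure lborel (lifetime \<inter> {t. cdf solution_law t \<in> N}) = emeasure (density lborel (indicator lifetime)) {t. cdf solution_law t \<in> N}"
    by (subst emeasure_density) (auto simp: indicator_inter_arith[symmetric])
  also have "\<dots> = emeasure clock {v. cdf solution_law (hitting_time v) \<in> N}"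
    unfolding distr_clock_hitting_time[symmetric] by (subst emeasure_distr) (auto simp: vimage_def)
  also have "\<dots> = (\<integral>\<^sup>+v. ennreal (q v) * indicator ({v. cdf solution_law (hitting_time v) \<in> N} \<inter> {0<..<1}) v \<partial>lborel)"
    by (rule emeasure_clock) measurable
  also have "\<dots> = (\<integral>\<^sup>+v. 0 \<partial>(lborel :: real measure))"
  proof (rule nn_integral_cong_AE)
    show "AE v in lborel. ennreal (q v) * indicator ({v. cdf solution_law (hitting_time v) \<in> N} \<inter> {0<..<1}) v = 0"
      using AE_not_in[OF N(1)] by eventually_elim (auto simp: cdf_solution_law split: split_indicator)
  qed
  finally have "emeasure lborel (lifetime \<inter> {t. cdf solution_law t \<in> N}) = 0" by simp
  then have "lifetime \<inter> {t. cdf solution_law t \<in> N} \<in> null_sets lborel" by (auto simp: null_sets_def)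
  from AE_not_in[OF this] show ?thesis by eventually_elim (use N(2) in auto)
qed

text \<open>
  A point strictly between two points of the support is a hitting time, because hitting times
  form an interval; continuity then gives mass to each of its neighbourhoods.
\<close>

lemma connected_support_solution_law: "connected (measure_support solution_law)"
proof -
  have "is_interval (measure_support solution_law)"
    unfolding is_interval_1
  proof (intro ballI allI impI)
    fix x z y assume x: "x \<in> measure_support solution_law" and z: "z \<in> measure_support solution_law"
      and xyz: "x \<le> y \<and> y \<le> z"
    have meets: "\<exists>v\<in>{0<..<1}. hitting_time v \<in> U" if "a \<in> measure_support solution_law" "a \<in> U" "open U" for a U
    proof (rule ccontr)
      assume "\<not> ?thesis"
      then have "{v \<in> {0<..<1}. hitting_time v \<in> U} = {}" by auto
      then have "emeasure solution_law U = 0"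
        using that by (subst emeasure_solution_law) (simp, simp only: emeasure_empty)
      then show False using that by (auto simp: measure_support_def)
    qed
    show "y \<in> measure_support solution_law"
    proof (cases "y = x \<or> y = z")
      case True then show ?thesis using x z by auto
    next
      case False
      then obtain u v where uv: "u \<in> {0<..<1}" "v \<in> {0<..<1}" "hitting_time u < y" "y < hitting_time v"
        using meets[OF x, of "{..<y}"] meets[OF z, of "{y<..}"] xyz by force
      then obtain w where w: "u \<le> w" "w \<le> v" "hitting_time w = y" using hitting_time_IVT[of u v y] by auto
      then have w01: "w \<in> {0<..<1}" using uv by auto
      show ?thesis
        unfolding measure_support_def
      proof safe
        fix U assume U: "open U" "y \<in> U"
        have "open ({0<..<1} \<inter> hitting_time -` U)"
          using continuous_on_hitting_time U by (auto intro: continuous_open_preimage)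
        moreover have "w \<in> {0<..<1} \<inter> hitting_time -` U" using w w01 U by auto
        ultimately obtain e where e: "e > 0" "ball w e \<subseteq> {0<..<1} \<inter> hitting_time -` U"
          unfolding open_contains_ball by blast
        have [measurable]: "U \<in> sets borel" using U by simp
        have meas: "{v \<in> {0<..<1}. hitting_time v \<in> U} \<in> sets borel" by measurable
        have "{w<..<w+e} \<subseteq> ball w e" by (auto simp: dist_real_def)
        then have sub: "{w<..<w+e} \<subseteq> {v \<in> {0<..<1}. hitting_time v \<in> U}" using e(2) by blast
        have "0 < emeasure lborel {w<..<w+e}" using e by simp
        also have "\<dots> \<le> emeasure lborel {v \<in> {0<..<1}. hitting_time v \<in> U}"
          using meas by (intro emeasure_mono sub) simp
        finally show "0 < emeasure solution_law U" using U by (simp add: emeasure_solution_law)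
      qed
    qed
  qed
  then show ?thesis by (simp add: is_interval_connected_1)
qed

lemma solution_law_in_connected_ac_distributions: "solution_law \<in> connected_ac_distributions"
proof -
  interpret real_distribution solution_law by (rule real_distribution_solution_law)
  have "absolutely_continuous lborel (density lborel (\<lambda>t. ennreal (indicator lifetime t * (1 / q (cdf solution_law t)))))"
    by (rule absolutely_continuousI_density) simp
  then have "absolutely_continuous lborel solution_law" by (simp only: solution_law_density[symmetric])
  then show ?thesis
    using prob_space_axioms connected_support_solution_law by (simp add: connected_ac_distributions_def)
qed

end

text \<open>
  The function \<open>I\<close> is only Lebesgue measurable and only almost everywhere finite; \<open>q\<close> is
  the reciprocal of a Borel version of \<open>I\<close>, cut off below at the Cheeger bound.
\<close>

theorem ex_distribution_with_derivative_profile: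
  fixes I :: "real \<Rightarrow> ereal"
  assumes I01: "I 0 = 0" "I 1 = 0" and h: "0 < h"
    and low: "\<And>v. 0 < v \<Longrightarrow> v < 1 \<Longrightarrow> ereal (h * min v (1 - v)) \<le> I v"
    and fin: "AE v in lborel. 0 < v \<and> v < 1 \<longrightarrow> I v < \<infinity>"
    and meas: "\<And>c. {v. 0 < v \<and> v < 1 \<and> I v < ereal c} \<in> sets lebesgue"
  shows "\<exists>\<nu>\<in>connected_ac_distributions. AE t in lborel.
           cdf \<nu> differentiable (at t) \<and> I (cdf \<nu> t) = ereal (deriv (cdf \<nu>) t)"
proof -
  define r where "r v = (if 0 < v \<and> v < 1 \<and> I v < \<infinity> then real_of_ereal (I v) else 0)" for v
  have Ir: "I v = ereal (r v)" if "0 < v" "v < 1" "I v < \<infinity>" for v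
  proof -
    have "ereal 0 \<le> ereal (h * min v (1 - v))" using h that by simp
    also have "\<dots> \<le> I v" using low that by simp
    finally show ?thesis using that by (cases "I v") (auto simp: r_def)
  qed
  have "r \<in> borel_measurable lebesgue"
    unfolding borel_measurable_iff_less
  proof
    fix c
    define F where "F = (\<Union>n::nat. {v. 0 < v \<and> v < 1 \<and> I v < ereal (real n)})"
    have F: "F \<in> sets lebesgue" unfolding F_def using meas by auto
    have F': "v \<in> F \<longleftrightarrow> 0 < v \<and> v < 1 \<and> I v < \<infinity>" for v
    proof
      assume "v \<in> F" then show "0 < v \<and> v < 1 \<and> I v < \<infinity>" by (auto simp: F_def)
    next
      assume v: "0 < v \<and> v < 1 \<and> I v < \<infinity>"
      obtain n :: nat where "r v < real n" using reals_Archimedean2 by blast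
      then show "v \<in> F" using v Ir[of v] by (auto simp: F_def)
    qed
    have "{w \<in> space lebesgue. r w < c} = (F \<inter> {v. 0 < v \<and> v < 1 \<and> I v < ereal c}) \<union> (if 0 < c then UNIV - F else {})"
    proof -
      have in_F: "r v < c \<longleftrightarrow> I v < ereal c" "0 < v" "v < 1" if "v \<in> F" for v
        using that Ir[of v] by (simp_all add: F')
      have not_F: "r v = 0" if "v \<notin> F" for v using that by (auto simp: F' r_def)
      show ?thesis
      proof (rule set_eqI)
        fix v
        show "v \<in> {w \<in> space lebesgue. r w < c} \<longleftrightarrow>
            v \<in> (F \<inter> {v. 0 < v \<and> v < 1 \<and> I v < ereal c}) \<union> (if 0 < c then UNIV - F else {})"
          using in_F[of v] not_F[of v] by (cases "v \<in> F") auto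
      qed
    qed
    also have "\<dots> \<in> sets lebesgue"
      using sets.compl_sets[OF F] sets.Int[OF F meas[of c]] by (auto intro!: sets.Un)
    finally show "{w \<in> space lebesgue. r w < c} \<in> sets lebesgue" .
  qed
  then obtain g where g: "g \<in> borel_measurable lborel" "AE v in lborel. r v = g v"
    using completion_ex_borel_measurable_real by blast
  define k where "k v = h * min v (1 - v)" for v
  have k: "0 < k v" if "0 < v" "v < 1" for v using h that by (simp add: k_def)
  \<comment> \<open>Where \<open>g v = I v\<close> the maximum is \<open>I v\<close>, by the lower bound on \<open>I\<close>; elsewhere it keeps \<open>q\<close> within its bounds.\<close>
  define q where "q v = 1 / max (g v) (k v)" for v
  interpret autonomous_ode q h
  proof
    show "q \<in> borel_measurable borel" unfolding q_def k_def using g(1) by simp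
    show "0 < q v" if "0 < v" "v < 1" for v using k[OF that] by (auto simp: q_def)
    show "q v \<le> 1 / (h * min v (1 - v))" if "0 < v" "v < 1" for v
      using k[OF that] unfolding q_def k_def[symmetric] by (intro divide_left_mono) (auto intro: mult_pos_pos)
  qed (rule h)
  have "AE v in lborel. 0 < v \<and> v < 1 \<longrightarrow> I v = ereal (1 / q v)"
    using fin g(2)
  proof eventually_elim
    case (elim v)
    then show ?case using Ir[of v] low[of v] by (auto simp: q_def k_def max_def)
  qed
  from AE_cdf_solution_law[OF this]
  have "AE t in lborel. cdf solution_law differentiable (at t) \<and> I (cdf solution_law t) = ereal (deriv (cdf solution_law) t)"
    using solution_law_derivative
  proof eventually_elim
    case (elim t)
    have d: "deriv (cdf solution_law) t = indicator lifetime t * (1 / q (cdf solution_law t))"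
      using elim(2) by (rule DERIV_imp_deriv)
    have "I (cdf solution_law t) = ereal (deriv (cdf solution_law) t)"
    proof (cases "t \<in> lifetime")
      case True
      then have "0 < cdf solution_law t" "cdf solution_law t < 1" by (auto simp: lifetime_def cdf_solution_law)
      then show ?thesis using elim(1) True by (simp add: d)
    next
      case False
      then show ?thesis using cdf_solution_law_outside[OF False] I01 by (auto simp: d zero_ereal_def)
    qed
    then show ?case using elim(2) real_differentiable_def by blast
  qed
  then show ?thesis using solution_law_in_connected_ac_distributions by blast
qed

section \<open>Coordinate balls in a Riemannian manifold\<close>

text \<open>
  The derivative of a piecewise smooth curve may be unbounded near a break point. If its norm has
  infinite integral there is nothing to show; otherwise it is integrable and the fundamental theorem applies.
\<close>

lemma norm_diff_le_nn_integral_derivative: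
  fixes f :: "real \<Rightarrow> 'b::euclidean_space"
  assumes ab: "a \<le> b" and S: "finite S" and cont: "continuous_on {a..b} f"
    and der: "\<And>t. t \<in> {a<..<b} - S \<Longrightarrow> (f has_vector_derivative D t) (at t)"
    and D: "continuous_on ({a<..<b} - S) D"
  shows "ennreal (norm (f b - f a)) \<le> (\<integral>\<^sup>+t. ennreal (norm (D t)) * indicator ({a<..<b} - S) t \<partial>lborel)"
proof -
  let ?A = "{a<..<b} - S"
  define E where "E t = indicator ?A t *\<^sub>R D t" for t
  have A: "?A \<in> sets borel" using S by (intro sets.Diff) (auto intro: finite_imp_closed borel_closed)
  \<comment> \<open>The definition of \<open>E\<close> sets the derivative to 0 at the exceptional points, where \<open>D\<close> carries no information.\<close>
  have E[measurable]: "E \<in> borel_measurable borel"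
    unfolding E_def by (rule borel_measurable_continuous_on_indicator[OF A D])
  have nE: "(\<integral>\<^sup>+t. ennreal (norm (D t)) * indicator ?A t \<partial>lborel) = (\<integral>\<^sup>+t. ennreal (norm (E t)) \<partial>lborel)"
    by (intro nn_integral_cong) (auto simp: E_def split: split_indicator)
  show ?thesis
  proof (cases "(\<integral>\<^sup>+t. ennreal (norm (E t)) \<partial>lborel) < \<infinity>")
    case True
    then have int: "integrable lborel E" by (intro integrableI_bounded) auto
    have "(E has_integral (f b - f a)) {a..b}"
    proof (rule fundamental_theorem_of_calculus_interior_strong[OF S ab _ cont])
      fix t assume t: "t \<in> {a<..<b} - S"
      then show "(f has_vector_derivative E t) (at t)" using der[OF t] by (simp add: E_def)
    qed
    then have "((\<lambda>t. if t \<in> {a..b} then E t else 0) has_integral (f b - f a)) UNIV"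
      by (simp only: has_integral_restrict_UNIV)
    also have "(\<lambda>t. if t \<in> {a..b} then E t else 0) = E" by (auto simp: E_def fun_eq_iff)
    finally have "f b - f a = integral\<^sup>L lborel E"
      using has_integral_integral_lborel[OF int] by (rule has_integral_unique)
    then show ?thesis using integral_norm_bound_ennreal[OF int] by (simp add: nE)
  next
    case False
    then show ?thesis by (simp add: nE not_less top_unique)
  qed
qed

locale riemannian_manifold =
  fixes \<A> :: "('a::{metric_space, second_countable_topology}, 'n::finite) chart set"
    and g :: "('a, 'n) chart \<Rightarrow> real ^ 'n \<Rightarrow> real ^ 'n ^ 'n"
  assumes manifold: "connected_riemannian_manifold \<A> g"
begin

lemma atlas: "smooth_atlas \<A>" and tensor: "metric_tensor \<A> g"
  and dist_eq: "ennreal (dist p q) = riemannian_distance \<A> g p q"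
  using manifold by (auto simp: connected_riemannian_manifold_def)

lemma charts_cover: "\<exists>c\<in>\<A>. p \<in> chart_dom c"
  using atlas by (auto simp: smooth_atlas_def)

lemma chart_props:
  assumes "c \<in> \<A>"
  shows "open (chart_dom c)" "open (chart_image c)" "continuous_on (chart_dom c) (chart_map c)"
    "continuous_on (chart_image c) (chart_inv c)" "inj_on (chart_map c) (chart_dom c)"
    "\<And>x. x \<in> chart_dom c \<Longrightarrow> chart_inv c (chart_map c x) = x"
    "\<And>y. y \<in> chart_image c \<Longrightarrow> chart_map c (chart_inv c y) = y"
    "\<And>y. y \<in> chart_image c \<Longrightarrow> chart_inv c y \<in> chart_dom c"
proof -
  have c: "open (chart_dom c)" "open (chart_image c)"
    "homeomorphism (chart_dom c) (chart_image c) (chart_map c) (chart_inv c)"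
    using atlas assms by (auto simp: smooth_atlas_def is_chart_def)
  then show "open (chart_dom c)" "open (chart_image c)" by auto
  show "continuous_on (chart_dom c) (chart_map c)" "continuous_on (chart_image c) (chart_inv c)"
    "\<And>x. x \<in> chart_dom c \<Longrightarrow> chart_inv c (chart_map c x) = x"
    using c(3) by (auto simp: homeomorphism_def)
  then show "inj_on (chart_map c) (chart_dom c)" by (metis inj_on_inverseI)
  show "\<And>y. y \<in> chart_image c \<Longrightarrow> chart_map c (chart_inv c y) = y"
    "\<And>y. y \<in> chart_image c \<Longrightarrow> chart_inv c y \<in> chart_dom c"
    by (auto simp: f_inv_into_f inv_into_into)
qed

lemma transition_differentiable:
  assumes "c \<in> \<A>" "c' \<in> \<A>" "p \<in> chart_dom c" "p \<in> chart_dom c'"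
  shows "transition c c' differentiable (at (chart_map c p))"
proof -
  have "smooth_on (transition c c') (chart_map c ` (chart_dom c \<inter> chart_dom c'))"
    using atlas assms by (auto simp: smooth_atlas_def)
  then have "Ck_on (Suc 0) (transition c c') (chart_map c ` (chart_dom c \<inter> chart_dom c'))"
    unfolding smooth_on_def by blast
  then show ?thesis using assms by auto
qed

lemma transition_chart_map:
  assumes "c \<in> \<A>" "x \<in> chart_dom c"
  shows "transition c c' (chart_map c x) = chart_map c' x"
  using chart_props(6)[OF assms] by (simp add: transition_def)

lemma continuous_on_metric:
  assumes "c \<in> \<A>"
  shows "continuous_on (chart_image c) (g c)"
proof -
  have "smooth_on (g c) (chart_image c)" using tensor assms by (auto simp: metric_tensor_def)
  then have "Ck_on 0 (g c) (chart_image c)" unfolding smooth_on_def by blast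
  then show ?thesis by simp
qed

text \<open>
  Compactness of the unit tangent vectors over \<open>K\<close>.
\<close>

lemma metric_tensor_lower_bound:
  assumes c: "c \<in> \<A>" and K: "compact K" "K \<subseteq> chart_image c"
  shows "\<exists>L>0. \<forall>x\<in>K. \<forall>v. norm v \<le> L * sqrt (v \<bullet> (g c x *v v))"
proof (cases "K = {}")
  case True then show ?thesis by (intro exI[of _ 1]) auto
next
  case False
  define F :: "(real^'n) \<times> (real^'n) \<Rightarrow> real" where "F z = snd z \<bullet> (g c (fst z) *v snd z)" for z
  have ij: "continuous_on (K \<times> sphere 0 1) (\<lambda>z. g c (fst z) $ i $ j)" for i j
  proof -
    have "continuous_on (K \<times> sphere 0 1) (\<lambda>z. g c (fst z))"
      by (rule continuous_on_compose2[OF continuous_on_metric[OF c]]) (use K in \<open>auto intro!: continuous_intros\<close>)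
    then show ?thesis by (intro continuous_intros)
  qed
  have contF: "continuous_on (K \<times> sphere 0 1) F"
    unfolding F_def inner_vec_def matrix_vector_mult_def
    by (simp, intro continuous_intros ij)
  obtain z0 where z0: "z0 \<in> K \<times> sphere 0 1" "\<And>z. z \<in> K \<times> sphere 0 1 \<Longrightarrow> F z0 \<le> F z"
  proof -
    have "compact (K \<times> sphere (0::real^'n) 1)" using K by (intro compact_Times) auto
    moreover have "K \<times> sphere (0::real^'n) 1 \<noteq> {}"
      using False vector_choose_size[of 1, where 'a="real^'n"] by (force simp: sphere_def)
    ultimately show ?thesis using continuous_attains_inf[OF _ _ contF] that by blast
  qed
  define m where "m = F z0"
  have "snd z0 \<noteq> 0" using z0(1) by (auto simp: mem_Times_iff)
  moreover have "fst z0 \<in> chart_image c" using z0(1) K by (auto simp: mem_Times_iff)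
  ultimately have m: "0 < m" unfolding m_def F_def using tensor c by (auto simp: metric_tensor_def)
  have bound: "norm v \<le> (1 / sqrt m) * sqrt (v \<bullet> (g c x *v v))" if x: "x \<in> K" for x v
  proof (cases "v = 0")
    case False
    define w where "w = (1 / norm v) *\<^sub>R v"
    have v: "v = norm v *\<^sub>R w" using False by (simp add: w_def)
    have "m \<le> F (x, w)" unfolding m_def using x False by (intro z0(2)) (auto simp: w_def)
    then have "m * (norm v)^2 \<le> F (x, w) * (norm v)^2" by (intro mult_right_mono) auto
    also have "\<dots> = v \<bullet> (g c x *v v)"
    proof -
      have gv: "g c x *v v = norm v *\<^sub>R (g c x *v w)"
        by (subst v) (simp only: matrix_vector_mult_scaleR)
      have "v \<bullet> (g c x *v v) = (norm v *\<^sub>R w) \<bullet> (norm v *\<^sub>R (g c x *v w))"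
        using v gv by metis
      then show ?thesis by (simp add: F_def power2_eq_square)
    qed
    finally have "sqrt (m * (norm v)^2) \<le> sqrt (v \<bullet> (g c x *v v))" by simp
    then have "sqrt m * norm v \<le> sqrt (v \<bullet> (g c x *v v))" by (simp add: real_sqrt_mult)
    then show ?thesis using m by (simp add: field_simps)
  qed simp
  show ?thesis using m bound by (intro exI[of _ "1 / sqrt m"]) auto
qed

text \<open>
  The definition of the speed selects some chart at \<open>\<gamma> t\<close>; the chain rule for the transition map and the
  transformation law of the metric tensor allow any other.
\<close>

lemma speed_in_chart:
  assumes c: "c \<in> \<A>" and pt: "\<gamma> t \<in> chart_dom c" and cont: "isCont \<gamma> t"
    and der: "((chart_map c \<circ> \<gamma>) has_vector_derivative v) (at t)"
  shows "speed \<A> g \<gamma> t = sqrt (v \<bullet> (g c (chart_map c (\<gamma> t)) *v v))"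
proof -
  define c' where "c' = (SOME c. c \<in> \<A> \<and> \<gamma> t \<in> chart_dom c)"
  have "\<exists>c. c \<in> \<A> \<and> \<gamma> t \<in> chart_dom c" using charts_cover by blast
  then have "c' \<in> \<A> \<and> \<gamma> t \<in> chart_dom c'" unfolding c'_def by (rule someI_ex)
  then have c': "c' \<in> \<A>" "\<gamma> t \<in> chart_dom c'" by auto
  define x where "x = chart_map c (\<gamma> t)"
  define J where "J = jacobian (transition c c') (at x)"
  have "(transition c c' has_derivative (\<lambda>h. J *v h)) (at x)"
    unfolding J_def using transition_differentiable[OF c c'(1) pt c'(2)] by (simp only: x_def jacobian_works)
  then have "(transition c c' has_derivative (\<lambda>h. J *v h)) (at ((chart_map c \<circ> \<gamma>) t))" by (simp add: x_def)
  from diff_chain_at[OF der[unfolded has_vector_derivative_def] this]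
  have "((transition c c' \<circ> (chart_map c \<circ> \<gamma>)) has_vector_derivative (J *v v)) (at t)"
    unfolding has_vector_derivative_def by (simp add: o_def matrix_vector_mult_scaleR)
  moreover have "\<forall>\<^sub>F s in at t. (transition c c' \<circ> (chart_map c \<circ> \<gamma>)) s = (chart_map c' \<circ> \<gamma>) s"
  proof -
    have "\<forall>\<^sub>F s in at t. \<gamma> s \<in> chart_dom c"
      using cont chart_props(1)[OF c] pt by (auto simp: isCont_def intro: topological_tendstoD)
    then show ?thesis by eventually_elim (simp add: transition_chart_map[OF c])
  qed
  moreover have "(transition c c' \<circ> (chart_map c \<circ> \<gamma>)) t = (chart_map c' \<circ> \<gamma>) t"
    using pt by (simp add: transition_chart_map[OF c])
  ultimately have "((chart_map c' \<circ> \<gamma>) has_vector_derivative (J *v v)) (at t)"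
    unfolding has_vector_derivative_def by (rule has_derivative_transform_eventually) auto
  then have vd: "vector_derivative (chart_map c' \<circ> \<gamma>) (at t) = J *v v" by (rule vector_derivative_at)
  have "x \<in> chart_map c ` (chart_dom c \<inter> chart_dom c')" using pt c' by (auto simp: x_def)
  then have "g c x = transpose J ** g c' (transition c c' x) ** J"
    using tensor c c'(1) unfolding metric_tensor_def J_def Let_def by blast
  moreover have "transition c c' x = chart_map c' (\<gamma> t)" unfolding x_def using pt by (rule transition_chart_map[OF c])
  ultimately have gx: "g c x = transpose J ** g c' (chart_map c' (\<gamma> t)) ** J" by simp
  have "v \<bullet> (g c x *v v) = v \<bullet> (transpose J *v (g c' (chart_map c' (\<gamma> t)) *v (J *v v)))"
    unfolding gx by (simp only: matrix_vector_mul_assoc matrix_mul_assoc)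
  also have "\<dots> = (J *v v) \<bullet> (g c' (chart_map c' (\<gamma> t)) *v (J *v v))"
    by (metis dot_lmul_matrix inner_commute transpose_matrix_vector)
  finally have "v \<bullet> (g c x *v v) = (J *v v) \<bullet> (g c' (chart_map c' (\<gamma> t)) *v (J *v v))" .
  then show ?thesis
    unfolding speed_def c'_def[symmetric] Let_def vd by (simp add: x_def)
qed

lemma chart_displacement_le_length:
  assumes c: "c \<in> \<A>" and curve: "piecewise_C1_curve \<A> \<gamma>" and T: "0 \<le> T" "T \<le> 1"
    and inK: "\<And>t. 0 \<le> t \<Longrightarrow> t \<le> T \<Longrightarrow> \<gamma> t \<in> chart_dom c \<and> chart_map c (\<gamma> t) \<in> K"
    and L: "0 < L" "\<And>x v. x \<in> K \<Longrightarrow> norm v \<le> L * sqrt (v \<bullet> (g c x *v v))"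
  shows "ennreal (dist (chart_map c (\<gamma> T)) (chart_map c (\<gamma> 0))) \<le> ennreal L * curve_length \<A> g \<gamma>"
proof -
  let ?f = "chart_map c \<circ> \<gamma>"
  have "?f piecewise_C1_differentiable_on {0..T}"
    using curve T inK c unfolding piecewise_C1_curve_def by (auto simp: image_subset_iff)
  then obtain S where S: "continuous_on {0..T} ?f" "finite S" "?f C1_differentiable_on ({0..T} - S)"
    unfolding piecewise_C1_differentiable_on_def by blast
  then obtain D where D: "\<And>t. t \<in> {0..T} - S \<Longrightarrow> (?f has_vector_derivative D t) (at t)" "continuous_on ({0..T} - S) D"
    unfolding C1_differentiable_on_def by blast
  let ?A = "{0<..<T} - S"
  have contD: "continuous_on ?A D" using D(2) by (rule continuous_on_subset) auto
  have A: "?A \<in> sets borel" using S by (intro sets.Diff) (auto intro: finite_imp_closed borel_closed)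
  have "(\<lambda>t. indicator ?A t *\<^sub>R D t) \<in> borel_measurable borel"
    by (rule borel_measurable_continuous_on_indicator[OF A contD])
  then have "(\<lambda>t. ennreal (norm (indicator ?A t *\<^sub>R D t))) \<in> borel_measurable lborel" by measurable
  also have "(\<lambda>t. ennreal (norm (indicator ?A t *\<^sub>R D t))) = (\<lambda>t. ennreal (norm (D t)) * indicator ?A t)"
    by (auto split: split_indicator)
  finally have meas: "(\<lambda>t. ennreal (norm (D t)) * indicator ?A t) \<in> borel_measurable lborel" .
  have "dist (chart_map c (\<gamma> T)) (chart_map c (\<gamma> 0)) = norm (?f T - ?f 0)" by (simp add: dist_norm)
  also have "ennreal \<dots> \<le> (\<integral>\<^sup>+t. ennreal (norm (D t)) * indicator ?A t \<partial>lborel)"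
    by (rule norm_diff_le_nn_integral_derivative[OF T(1) S(2,1) _ contD]) (use D(1) in auto)
  also have "\<dots> = (\<integral>\<^sup>+t. ennreal L * (ennreal (1 / L) * (ennreal (norm (D t)) * indicator ?A t)) \<partial>lborel)"
    using L(1) by (intro nn_integral_cong) (simp add: mult.assoc[symmetric] ennreal_mult[symmetric])
  also have "\<dots> = ennreal L * (\<integral>\<^sup>+t. ennreal (1 / L) * (ennreal (norm (D t)) * indicator ?A t) \<partial>lborel)"
    by (rule nn_integral_cmult) (use meas in measurable)
  also have "(\<integral>\<^sup>+t. ennreal (1 / L) * (ennreal (norm (D t)) * indicator ?A t) \<partial>lborel) \<le> curve_length \<A> g \<gamma>"
    unfolding curve_length_def
  proof (rule nn_integral_mono)
    fix t
    show "ennreal (1 / L) * (ennreal (norm (D t)) * indicator ?A t) \<le> ennreal (speed \<A> g \<gamma> t) * indicator {0..1} t"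
    proof (cases "t \<in> ?A")
      case True
      have "isCont \<gamma> t"
        using curve True T by (intro continuous_on_interior[of "{0..1}"]) (auto simp: piecewise_C1_curve_def)
      then have sp: "speed \<A> g \<gamma> t = sqrt (D t \<bullet> (g c (chart_map c (\<gamma> t)) *v D t))"
        using inK[of t] True D(1)[of t] by (intro speed_in_chart[OF c]) auto
      have "norm (D t) \<le> L * speed \<A> g \<gamma> t" unfolding sp using inK[of t] True by (intro L(2)) auto
      then have "norm (D t) / L \<le> speed \<A> g \<gamma> t" using L(1) by (simp add: field_simps)
      then show ?thesis using True T L(1) by (auto simp: ennreal_mult[symmetric] intro!: ennreal_leI)
    qed simp
  qed
  finally show ?thesis by (simp add: mult_left_mono)
qed

text \<open>
  The condition \<open>x \<in> chart_dom c\<close> matters because the values of a chart map outside its domain are arbitrary.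
\<close>

definition coord_ball :: "('a, 'n) chart \<Rightarrow> 'a \<Rightarrow> real \<Rightarrow> 'a set" where
  "coord_ball c p s = {x \<in> chart_dom c. dist (chart_map c x) (chart_map c p) \<le> s}"

lemma coord_ball_eq_image:
  assumes "c \<in> \<A>" "cball (chart_map c p) s \<subseteq> chart_image c"
  shows "coord_ball c p s = chart_inv c ` cball (chart_map c p) s"
proof (intro equalityI subsetI)
  fix x assume "x \<in> coord_ball c p s"
  then show "x \<in> chart_inv c ` cball (chart_map c p) s"
    using chart_props(6)[OF assms(1), of x] by (auto simp: coord_ball_def dist_commute intro!: image_eqI[of _ _ "chart_map c x"])
next
  fix x assume "x \<in> chart_inv c ` cball (chart_map c p) s"
  then show "x \<in> coord_ball c p s"
    using chart_props(7,8)[OF assms(1)] assms(2) by (auto simp: coord_ball_def dist_commute subset_iff)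
qed

lemma compact_coord_ball:
  assumes "c \<in> \<A>" "cball (chart_map c p) s \<subseteq> chart_image c"
  shows "compact (coord_ball c p s)"
  unfolding coord_ball_eq_image[OF assms]
  by (rule compact_continuous_image[OF continuous_on_subset[OF chart_props(4)[OF assms(1)] assms(2)]]) simp

text \<open>
  A chart is Lipschitz near \<open>p\<close> for the Riemannian distance. As long as a curve of length \<open>l < \<epsilon>\<close> that starts
  in the ball of radius \<open>s\<close> stays in the open coordinate ball \<open>W\<close> of radius \<open>s + L * \<epsilon>\<close>, its coordinates move by at most
  \<open>L * l\<close>. It is then in the compact ball of radius \<open>s + L * l\<close>, which is contained in \<open>W\<close>, so it has no first exit
  time from \<open>W\<close>.
\<close>

theorem open_nbhd_coord_ball:
  assumes c: "c \<in> \<A>" and r: "cball (chart_map c p) r \<subseteq> chart_image c"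
  obtains L where "0 < L" "\<And>s \<epsilon>. s + L * \<epsilon> \<le> r \<Longrightarrow> open_nbhd \<epsilon> (coord_ball c p s) \<subseteq> coord_ball c p (s + L * \<epsilon>)"
proof -
  let ?K = "cball (chart_map c p) r"
  obtain L where L: "0 < L" "\<And>x v. x \<in> ?K \<Longrightarrow> norm v \<le> L * sqrt (v \<bullet> (g c x *v v))"
    using metric_tensor_lower_bound[OF c _ r] by auto
  show ?thesis
  proof (rule that[OF L(1)], rule subsetI)
    fix s \<epsilon> y assume le: "s + L * \<epsilon> \<le> r" and "y \<in> open_nbhd \<epsilon> (coord_ball c p s)"
    then obtain x where x: "x \<in> coord_ball c p s" and xy: "dist x y < \<epsilon>" by (auto simp: open_nbhd_def)
    have e: "0 < \<epsilon>" using xy by (meson le_less_trans zero_le_dist)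
    have "riemannian_distance \<A> g x y < ennreal \<epsilon>"
      unfolding dist_eq[symmetric] using xy by (simp add: ennreal_lessI e)
    then obtain \<gamma> where \<gamma>: "piecewise_C1_curve \<A> \<gamma>" "\<gamma> 0 = x" "\<gamma> 1 = y" "curve_length \<A> g \<gamma> < ennreal \<epsilon>"
      unfolding riemannian_distance_def by (auto simp: INF_less_iff)
    obtain l where l: "curve_length \<A> g \<gamma> = ennreal l" "0 \<le> l" "l < \<epsilon>"
      using \<gamma>(4) by (cases "curve_length \<A> g \<gamma>") (auto simp: ennreal_less_iff)
    define s' where "s' = s + L * l"
    have s': "s' < s + L * \<epsilon>" "s \<le> s'" "s' \<le> r" 
    proof -
      have "L * l < L * \<epsilon>" using l L(1) by simp
      moreover have "0 \<le> L * l" using l L(1) by simp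
      ultimately show "s' < s + L * \<epsilon>" "s \<le> s'" "s' \<le> r" using le unfolding s'_def by linarith+
    qed
    define W where "W = {z \<in> chart_dom c. dist (chart_map c z) (chart_map c p) < s + L * \<epsilon>}"
    have openW: "open W"
    proof -
      have "W = chart_dom c \<inter> chart_map c -` ball (chart_map c p) (s + L * \<epsilon>)"
        by (auto simp: W_def dist_commute)
      then show ?thesis using chart_props(1,3)[OF c] by (auto intro: continuous_open_preimage)
    qed
    have W_sub: "coord_ball c p s' \<subseteq> W" using s' by (auto simp: W_def coord_ball_def)
    have cont: "continuous_on {0..1} \<gamma>" using \<gamma>(1) by (simp add: piecewise_C1_curve_def)
    have confined: "\<gamma> T \<in> coord_ball c p s'" if T: "0 \<le> T" "T \<le> 1" and in_W: "\<And>t. 0 \<le> t \<Longrightarrow> t \<le> T \<Longrightarrow> \<gamma> t \<in> W" for T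
    proof -
      have "ennreal (dist (chart_map c (\<gamma> T)) (chart_map c (\<gamma> 0))) \<le> ennreal L * curve_length \<A> g \<gamma>"
      proof (rule chart_displacement_le_length[OF c \<gamma>(1) T _ L])
        fix t assume "0 \<le> t" "t \<le> T"
        then show "\<gamma> t \<in> chart_dom c \<and> chart_map c (\<gamma> t) \<in> ?K"
          using in_W[of t] le by (auto simp: W_def dist_commute)
      qed
      also have "\<dots> = ennreal (L * l)" using l L by (simp add: ennreal_mult)
      finally have "dist (chart_map c (\<gamma> T)) (chart_map c x) \<le> L * l"
        using l L \<gamma>(2) by (subst (asm) ennreal_le_iff) auto
      moreover have "dist (chart_map c x) (chart_map c p) \<le> s" using x by (simp add: coord_ball_def)
      ultimately have "dist (chart_map c (\<gamma> T)) (chart_map c p) \<le> s'"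
        using dist_triangle[of "chart_map c (\<gamma> T)" "chart_map c p" "chart_map c x"] by (simp add: s'_def)
      then show ?thesis using in_W[of T] T by (auto simp: coord_ball_def W_def)
    qed
    have "\<gamma> t \<in> W" if t: "0 \<le> t" "t \<le> 1" for t
    proof (rule ccontr)
      assume "\<gamma> t \<notin> W"
      define B where "B = {t \<in> {0..1}. \<gamma> t \<notin> W}"
      have "B = {0..1} \<inter> \<gamma> -` (- W)" by (auto simp: B_def)
      then have closedB: "closed B" using cont openW by (auto intro: continuous_closed_preimage)
      have "t \<in> B" using t \<open>\<gamma> t \<notin> W\<close> by (simp add: B_def)
      define \<tau> where "\<tau> = Inf B"
      have bdd: "bdd_below B" by (rule bdd_belowI[of _ 0]) (simp add: B_def)
      have "\<tau> \<in> B" unfolding \<tau>_def using closedB \<open>t \<in> B\<close> bdd by (intro closed_contains_Inf) auto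
      then have \<tau>: "0 \<le> \<tau>" "\<tau> \<le> 1" "\<gamma> \<tau> \<notin> W" by (auto simp: B_def)
      have before: "\<gamma> u \<in> W" if "0 \<le> u" "u < \<tau>" for u
        using cInf_lower[OF _ bdd, of u] that \<tau> unfolding \<tau>_def[symmetric] by (force simp: B_def)
      have "x \<in> W" using x s' by (auto simp: W_def coord_ball_def)
      then have "\<tau> \<noteq> 0" using \<tau>(3) \<gamma>(2) by metis
      then have "0 < \<tau>" using \<tau> by simp
      have closed: "closed (coord_ball c p s')"
        using s' r by (intro compact_imp_closed compact_coord_ball[OF c]) (auto intro: order_trans[OF subset_cball])
      have "(\<gamma> \<longlongrightarrow> \<gamma> \<tau>) (at \<tau> within {0..1})" using cont \<tau> by (auto simp: continuous_on)
      then have lim: "(\<gamma> \<longlongrightarrow> \<gamma> \<tau>) (at \<tau> within {0..<\<tau>})"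
        by (rule tendsto_within_subset) (use \<tau> in auto)
      have "\<gamma> \<tau> \<in> coord_ball c p s'"
      proof (rule Lim_in_closed_set[OF closed _ _ lim])
        show "\<forall>\<^sub>F u in at \<tau> within {0..<\<tau>}. \<gamma> u \<in> coord_ball c p s'"
          unfolding eventually_at_filter
          by (intro always_eventually allI impI confined before) (use \<tau> in auto)
        show "at \<tau> within {0..<\<tau>} \<noteq> bot"
          using \<open>0 < \<tau>\<close> by (simp add: trivial_limit_within islimpt_Ico)
      qed
      then show False using W_sub \<tau>(3) by blast
    qed
    then have "\<gamma> 1 \<in> coord_ball c p s'" by (intro confined) auto
    then show "y \<in> coord_ball c p (s + L * \<epsilon>)" using \<gamma>(3) s' by (auto simp: coord_ball_def)
  qed
qed

end

section \<open>Finiteness of the profile\<close>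

text \<open>
  The measure \<open>N\<close> that is 0 on the subsets of \<open>E\<close> and infinite on all other sets is an upper bound of the
  measures \<open>M i\<close>.
\<close>

lemma emeasure_SUP_measure_eq_0:
  fixes M :: "'i \<Rightarrow> 'a::topological_space measure"
  assumes I: "I \<noteq> {}" and sets: "\<And>i. i \<in> I \<Longrightarrow> sets (M i) = sets borel"
    and E: "E \<in> sets borel" and null: "\<And>i. i \<in> I \<Longrightarrow> emeasure (M i) E = 0"
  shows "emeasure (SUP i\<in>I. M i) E = 0"
proof -
  \<comment> \<open>Infinity times the number of points outside \<open>E\<close>.\<close>
  define N :: "'a measure" where "N = scale_measure \<infinity> (distr (count_space (- E)) borel (\<lambda>x. x))"
  have sN: "sets N = sets borel" by (simp add: N_def)
  have N: "emeasure N A = \<infinity> * emeasure (count_space (- E)) (A \<inter> - E)" if "A \<in> sets borel" for A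
    using that by (simp add: N_def emeasure_distr)
  have "M i \<le> N" if i: "i \<in> I" for i
  proof -
    have "emeasure (M i) A \<le> emeasure N A" for A
    proof (cases "A \<in> sets borel")
      case True
      show ?thesis
      proof (cases "A \<subseteq> E")
        case True
        then have "emeasure (M i) A \<le> emeasure (M i) E" using E sets[OF i] by (intro emeasure_mono) auto
        then show ?thesis using null[OF i] by simp
      next
        case False
        then have "emeasure (count_space (- E)) (A \<inter> - E) \<noteq> 0" by (auto simp: emeasure_count_space_eq_0)
        then show ?thesis using N[OF \<open>A \<in> sets borel\<close>] by (simp add: ennreal_top_mult)
      qed
    next
      case False
      then show ?thesis using sets[OF i] by (simp add: emeasure_notin_sets)
    qed
    then show ?thesis
      using sets[OF i] sN sets_eq_imp_space_eq[OF sets[OF i]] sets_eq_imp_space_eq[OF sN]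
      by (simp add: le_measure_iff le_fun_def)
  qed
  then have "(SUP i\<in>I. M i) \<le> N" by (rule SUP_least)
  moreover have "sets (SUP i\<in>I. M i) = sets N" using sets_SUP[of I M N] sets sN I by simp
  ultimately have "emeasure (SUP i\<in>I. M i) E \<le> emeasure N E"
    using sets_eq_imp_space_eq[of "SUP i\<in>I. M i" N] by (auto simp: le_measure_iff le_fun_def)
  also have "\<dots> = 0" using N[OF E] by simp
  finally show ?thesis by simp
qed

text \<open>
  Under the uniform distribution on a ball of radius \<open>r\<close> in dimension \<open>n\<close> the distance to the centre has the
  distribution function \<open>(s / r) ^ n\<close>, which is Lipschitz.
\<close>

lemma null_sets_dist_vimage:
  fixes a :: "'b::euclidean_space"
  assumes r: "0 < r" and N: "N \<in> null_sets lborel"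
  shows "{x \<in> cball a r. dist x a \<in> N} \<in> null_sets lborel"
proof -
  define n where "n = DIM('b)"
  define u where "u x = dist x a" for x
  have u[measurable]: "u \<in> borel_measurable borel" unfolding u_def by (intro borel_measurable_continuous_onI continuous_intros)
  have [measurable]: "N \<in> sets borel" using N by auto
  have V: "0 < unit_ball_vol (real n)" by simp
  have em: "emeasure lborel (cball a s) = ennreal (unit_ball_vol n * s ^ n)" if "0 \<le> s" for s
    using that by (simp add: emeasure_cball n_def)
  define P where "P = uniform_measure lborel (cball a r)"
  have P: "prob_space P" unfolding P_def
    by (rule prob_space_uniform_measure) (use em[of r] r V in \<open>auto simp: ennreal_eq_0_iff not_le\<close>)
  interpret P: prob_space P by fact
  have [measurable_cong]: "sets P = sets borel" by (simp add: P_def)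
  define M where "M = distr P borel u"
  interpret M: real_distribution M unfolding M_def by (rule P.real_distribution_distr) simp
  define clip where "clip s = max 0 (min 1 (s / r))" for s
  have cdfM: "cdf M s = clip s ^ n" for s
  proof -
    have "emeasure M {..s} = emeasure lborel (cball a r \<inter> {x. u x \<le> s}) / emeasure lborel (cball a r)"
      unfolding M_def P_def by (subst emeasure_distr) (auto simp: vimage_def)
    also have "\<dots> = ennreal (clip s ^ n)"
    proof (cases "s < 0")
      case True
      then have "\<not> u x \<le> s" for x using zero_le_dist[of x a] unfolding u_def by linarith
      then have "cball a r \<inter> {x. u x \<le> s} = {}" by auto
      moreover have "clip s = 0" using divide_neg_pos[OF True r] by (simp add: clip_def)
      ultimately show ?thesis by (simp add: n_def)
    next
      case False
      then have "cball a r \<inter> {x. u x \<le> s} = cball a (min s r)" by (auto simp: u_def dist_commute)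
      then have "emeasure lborel (cball a r \<inter> {x. u x \<le> s}) / emeasure lborel (cball a r)
          = ennreal (unit_ball_vol n * (min s r) ^ n) / ennreal (unit_ball_vol n * r ^ n)"
        using False r em by simp
      also have "\<dots> = ennreal ((unit_ball_vol n * (min s r) ^ n) / (unit_ball_vol n * r ^ n))"
        using False r V by (intro divide_ennreal) auto
      also have "(unit_ball_vol n * (min s r) ^ n) / (unit_ball_vol n * r ^ n) = (min s r / r) ^ n"
        using less_imp_neq[OF V] by (subst nonzero_mult_divide_mult_cancel_left) (simp_all add: power_divide)
      also have "min s r / r = clip s" using r False by (auto simp: clip_def min_def max_def field_simps)
      finally show ?thesis .
    qed
    finally show ?thesis by (simp add: cdf_def measure_def clip_def)
  qed
  have "absolutely_continuous lborel M"
  proof (rule lipschitz_cdf_imp_absolutely_continuous[OF M.real_distribution_axioms])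
    fix x y :: real assume "x \<le> y"
    have "norm (clip y ^ n - clip x ^ n) \<le> real n * norm (clip y - clip x)"
      by (rule norm_power_diff) (auto simp: clip_def)
    also have "\<dots> \<le> real n * ((y - x) / r)"
    proof (intro mult_left_mono)
      have "x / r \<le> y / r" using \<open>x \<le> y\<close> r by (simp add: divide_right_mono)
      then show "norm (clip y - clip x) \<le> (y - x) / r" by (auto simp: clip_def diff_divide_distrib min_def max_def)
    qed simp
    finally show "cdf M y - cdf M x \<le> (real n / r) * (y - x)" by (simp add: cdfM)
  qed
  then have "emeasure M N = 0" using N by (auto simp: absolutely_continuous_def)
  moreover have "emeasure M N = emeasure lborel (cball a r \<inter> {x. u x \<in> N}) / emeasure lborel (cball a r)"
    unfolding M_def P_def by (subst emeasure_distr) (auto simp: vimage_def)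
  ultimately have "emeasure lborel (cball a r \<inter> {x. u x \<in> N}) = 0"
    using em[of r] r by (auto simp: ennreal_divide_eq_0_iff)
  moreover have "cball a r \<inter> {x. u x \<in> N} = {x \<in> cball a r. dist x a \<in> N}" by (auto simp: u_def)
  moreover have "cball a r \<inter> {x. u x \<in> N} \<in> sets lborel" by simp
  ultimately show ?thesis by (auto simp: null_sets_def)
qed

lemma null_sets_affine_vimage:
  fixes a b :: real
  assumes N: "N \<in> null_sets lborel" and b: "b \<noteq> 0"
  shows "{s. a + b * s \<in> N} \<in> null_sets lborel"
proof -
  have [measurable]: "N \<in> sets borel" using N by auto
  have "emeasure lborel N = emeasure (density (distr lborel borel (\<lambda>x. a + b * x)) (\<lambda>_. ennreal \<bar>b\<bar>)) N"
    using lborel_real_affine[OF b, of a] by simp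
  also have "\<dots> = ennreal \<bar>b\<bar> * emeasure lborel {s. a + b * s \<in> N}"
    by (subst emeasure_density, simp, simp, subst nn_integral_cmult_indicator)
       (auto simp: emeasure_distr vimage_def)
  finally have "emeasure lborel {s. a + b * s \<in> N} = 0" using N b by auto
  moreover have "{s. a + b * s \<in> N} \<in> sets borel" by measurable
  ultimately show ?thesis by (auto simp: null_sets_def)
qed

locale riemannian_probability = riemannian_manifold \<A> g + borel_prob_space \<mu>
  for \<A> :: "('a::{metric_space, second_countable_topology}, 'n::finite) chart set"
    and g :: "('a, 'n) chart \<Rightarrow> real ^ 'n \<Rightarrow> real ^ 'n ^ 'n"
    and \<mu> :: "'a measure" +
  assumes abs_cont: "absolutely_continuous (riemannian_volume \<A> g) \<mu>"
begin

lemma continuous_on_det_metric: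
  assumes c: "c \<in> \<A>"
  shows "continuous_on (chart_image c) (\<lambda>x. det (g c x))"
  unfolding det_def by (intro continuous_intros continuous_on_metric[OF c])

lemma chart_volume_eq_0:
  assumes c: "c \<in> \<A>" and E: "E \<in> sets borel" and null: "negligible (chart_map c ` (E \<inter> chart_dom c))"
  shows "emeasure (chart_volume g c) E = 0"
proof -
  let ?R = "restrict_space lborel (chart_image c)"
  let ?f = "\<lambda>x. ennreal (sqrt (det (g c x)))"
  have op[measurable]: "chart_image c \<in> sets borel" using chart_props(2)[OF c] by auto
  have sR: "sets ?R = sets (restrict_space borel (chart_image c))" by (simp add: sets_restrict_space)
  have inv: "chart_inv c \<in> ?R \<rightarrow>\<^sub>M borel"
    unfolding measurable_cong_sets[OF sR refl]
    by (rule borel_measurable_continuous_on_restrict[OF chart_props(4)[OF c]])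
  have "(\<lambda>x. sqrt (det (g c x))) \<in> borel_measurable ?R"
    unfolding measurable_cong_sets[OF sR refl]
    by (intro borel_measurable_continuous_on_restrict continuous_intros continuous_on_det_metric[OF c])
  then have f: "?f \<in> borel_measurable ?R" by measurable
  define A where "A = chart_inv c -` E \<inter> space ?R"
  have A: "A \<in> sets ?R" unfolding A_def using inv E by (rule measurable_sets)
  have Ab: "A \<in> sets borel" using A op by (auto simp: sets_restrict_space)
  have "A = chart_map c ` (E \<inter> chart_dom c)"
    using chart_props(6,7,8)[OF c] by (force simp: A_def space_restrict_space image_iff)
  then have "negligible A" using null by simp
  then have "A \<in> null_sets lborel" using Ab by (simp add: negligible_iff_null_sets null_sets_completion_iff)
  then have "A \<in> null_sets ?R"
    using A op by (auto simp: null_sets_restrict_space sets_restrict_space)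
  then have "A \<in> null_sets (density ?R ?f)"
    using absolutely_continuousI_density[OF f] by (auto simp: absolutely_continuous_def)
  then have "emeasure (density ?R ?f) A = 0" by auto
  then show ?thesis
    unfolding chart_volume_def using inv E by (subst emeasure_distr) (auto simp: A_def)
qed

text \<open>
  Transition maps are differentiable and thus preserve null sets, so \<open>E\<close> is null for the volume
  of every chart, hence for their supremum, the Riemannian volume.
\<close>

lemma negligible_in_chart_imp_null:
  assumes c: "c \<in> \<A>" and E: "E \<in> sets borel" "E \<subseteq> chart_dom c" and null: "negligible (chart_map c ` E)"
  shows "E \<in> null_sets \<mu>"
proof -
  have "emeasure (chart_volume g c') E = 0" if c': "c' \<in> \<A>" for c'
  proof (rule chart_volume_eq_0[OF c' E(1)])
    let ?S = "chart_map c ` (E \<inter> chart_dom c')"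
    have "chart_map c' ` (E \<inter> chart_dom c') = transition c c' ` ?S"
      unfolding image_image by (rule image_cong) (use E(2) in \<open>auto simp: transition_chart_map[OF c]\<close>)
    moreover have "negligible (transition c c' ` ?S)"
    proof (rule negligible_differentiable_image_negligible)
      show "negligible ?S" by (intro negligible_subset[OF null] image_mono) auto
      show "transition c c' differentiable_on ?S"
        unfolding differentiable_on_def
      proof
        fix y assume "y \<in> ?S"
        then obtain x where x: "x \<in> E" "x \<in> chart_dom c'" and y: "y = chart_map c x" by blast
        have "x \<in> chart_dom c" using x(1) E(2) by blast
        then have "transition c c' differentiable (at y)"
          unfolding y by (rule transition_differentiable[OF c c' _ x(2)])
        then show "transition c c' differentiable at y within ?S" by (rule differentiable_at_withinI)
      qed
    qed simp
    ultimately show "negligible (chart_map c' ` (E \<inter> chart_dom c'))" by simp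
  qed
  moreover have "\<A> \<noteq> {}" using charts_cover by auto
  ultimately have "emeasure (riemannian_volume \<A> g) E = 0"
    unfolding riemannian_volume_def using E by (intro emeasure_SUP_measure_eq_0) (auto simp: chart_volume_def)
  moreover have "sets (riemannian_volume \<A> g) = sets borel"
    unfolding riemannian_volume_def using \<open>\<A> \<noteq> {}\<close> by (intro sets_SUP) (auto simp: chart_volume_def)
  ultimately have "E \<in> null_sets (riemannian_volume \<A> g)" using E by (auto simp: null_sets_def)
  then show ?thesis using abs_cont by (auto simp: absolutely_continuous_def)
qed

text \<open>
  The value \<open>-1\<close> keeps the points outside the chart domain out of every coordinate ball.
\<close>

definition coord_radius :: "('a, 'n) chart \<Rightarrow> 'a \<Rightarrow> 'a \<Rightarrow> real" where
  "coord_radius c p x = (if x \<in> chart_dom c then dist (chart_map c x) (chart_map c p) else -1)"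

lemma coord_ball_eq: "coord_ball c p s = {x. 0 \<le> coord_radius c p x \<and> coord_radius c p x \<le> s}"
  by (auto simp: coord_ball_def coord_radius_def)

lemma coord_radius_measurable:
  assumes "c \<in> \<A>"
  shows "coord_radius c p \<in> borel_measurable borel"
  unfolding coord_radius_def using chart_props(1,3)[OF assms]
  by (intro borel_measurable_continuous_on_if) (auto intro!: continuous_intros)

lemma coord_ball_measurable:
  assumes "c \<in> \<A>"
  shows "coord_ball c p s \<in> sets borel"
proof -
  note [measurable] = coord_radius_measurable[OF assms]
  show ?thesis unfolding coord_ball_eq by measurable
qed

lemma coord_radius_null_vimage:
  assumes c: "c \<in> \<A>" and r: "0 < r" and N: "N \<in> null_sets lborel"
  shows "{x \<in> coord_ball c p r. coord_radius c p x \<in> N} \<in> null_sets \<mu>"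
proof (rule negligible_in_chart_imp_null[OF c])
  note [measurable] = coord_radius_measurable[OF c] coord_ball_measurable[OF c]
  have [measurable]: "N \<in> sets borel" using N by auto
  show "{x \<in> coord_ball c p r. coord_radius c p x \<in> N} \<in> sets borel" by measurable
  show "{x \<in> coord_ball c p r. coord_radius c p x \<in> N} \<subseteq> chart_dom c" by (auto simp: coord_ball_def)
  have "chart_map c ` {x \<in> coord_ball c p r. coord_radius c p x \<in> N} \<subseteq>
      {y \<in> cball (chart_map c p) r. dist y (chart_map c p) \<in> N}"
    by (auto simp: coord_ball_def coord_radius_def dist_commute)
  moreover have "negligible {y \<in> cball (chart_map c p) r. dist y (chart_map c p) \<in> N}"
    using null_sets_completionI[OF null_sets_dist_vimage[OF r N, of "chart_map c p"]]
    by (simp only: negligible_iff_null_sets)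
  ultimately show "negligible (chart_map c ` {x \<in> coord_ball c p r. coord_radius c p x \<in> N})"
    by (rule negligible_subset[rotated])
qed

text \<open>
  The measure of the coordinate ball of radius \<open>s\<close> is the distribution function of an absolutely
  continuous law of radii, so it is differentiable at almost every \<open>s\<close>; an \<open>\<epsilon>\<close>-neighbourhood enlarges the
  radius by at most \<open>L * \<epsilon>\<close>.
\<close>

theorem AE_coord_ball_finite_boundary:
  assumes c: "c \<in> \<A>" and r: "0 < r" "cball (chart_map c p) r \<subseteq> chart_image c"
  shows "AE s in lborel. s < r \<longrightarrow> boundary_measure \<mu> (coord_ball c p s) < \<infinity>"
proof -
  note [measurable] = coord_radius_measurable[OF c] coord_ball_measurable[OF c]
  let ?u = "coord_radius c p" and ?B = "coord_ball c p"
  obtain L where L: "0 < L" "\<And>s \<epsilon>. s + L * \<epsilon> \<le> r \<Longrightarrow> open_nbhd \<epsilon> (?B s) \<subseteq> ?B (s + L * \<epsilon>)"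
    by (rule open_nbhd_coord_ball[OF c r(2)]) (rule that)
  define M where "M = distr (density \<mu> (indicator (?B r))) borel ?u"
  have M: "emeasure M A = emeasure \<mu> (?B r \<inter> {x. ?u x \<in> A})" if [measurable]: "A \<in> sets borel" for A
  proof -
    have s: "{x. ?u x \<in> A} \<in> sets borel" by measurable
    have "emeasure M A = emeasure (density \<mu> (indicator (?B r))) {x. ?u x \<in> A}"
      unfolding M_def by (subst emeasure_distr) (auto simp: vimage_def)
    also have "\<dots> = emeasure \<mu> (?B r \<inter> {x. ?u x \<in> A})"
      using s by (subst emeasure_density) (auto simp: indicator_inter_arith[symmetric])
    finally show ?thesis .
  qed
  have "finite_measure M"
    by (rule finite_measureI) (simp add: M sets_eq_imp_space_eq[of M borel] M_def[THEN arg_cong[where f=space]])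
  moreover have sM: "sets M = sets borel" by (simp add: M_def)
  moreover have "absolutely_continuous lborel M"
    unfolding absolutely_continuous_def
  proof
    fix N :: "real set" assume N: "N \<in> null_sets lborel"
    have "?B r \<inter> {x. ?u x \<in> N} = {x \<in> ?B r. ?u x \<in> N}" by auto
    then have "emeasure M N = 0" using coord_radius_null_vimage[OF c r(1) N, of p] N by (subst M) auto
    then show "N \<in> null_sets M" using N sM by (auto simp: null_sets_def)
  qed
  ultimately obtain d where d: "AE s in lborel. (cdf M has_real_derivative d s) (at s)"
    using absolutely_continuous_cdf_derivative by metis
  then show ?thesis
  proof eventually_elim
    case (elim s)
    show ?case
    proof
      assume "s < r"
      have cdfM: "cdf M s' = prob (?B s')" if "s' \<le> r" for s'
      proof -
        have "?B r \<inter> {x. ?u x \<in> {..s'}} = ?B s'" using that by (auto simp: coord_ball_eq)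
        then show ?thesis by (simp add: cdf_def measure_def M)
      qed
      have "((\<lambda>h. (cdf M (s + h) - cdf M s) / h) \<longlongrightarrow> d s) (at_right 0)"
        using elim unfolding DERIV_def by (rule tendsto_mono[OF at_le, rotated]) simp
      then have "\<forall>\<^sub>F h in at_right 0. (cdf M (s + h) - cdf M s) / h < d s + 1"
        by (rule order_tendstoD(2)) simp
      then obtain e where e: "0 < e" "\<And>h. 0 < h \<Longrightarrow> h < e \<Longrightarrow> (cdf M (s + h) - cdf M s) / h < d s + 1"
        unfolding eventually_at_right_field by auto
      have "\<forall>\<^sub>F \<epsilon> in at_right 0. \<epsilon> < e / L \<and> \<epsilon> < (r - s) / L \<and> 0 < \<epsilon>"
        using e L(1) \<open>s < r\<close> by (auto intro!: eventually_conj eventually_at_right_less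
          order_tendstoD(2)[of "\<lambda>x. x", OF tendsto_ident_at])
      then have "\<forall>\<^sub>F \<epsilon> in at_right 0. prob (open_nbhd \<epsilon> (?B s)) - prob (?B s) \<le> ((d s + 1) * L) * \<epsilon>"
      proof eventually_elim
        case (elim \<epsilon>)
        then have h: "0 < L * \<epsilon>" "L * \<epsilon> < e" "s + L * \<epsilon> \<le> r" using L(1) by (auto simp: field_simps)
        have "prob (open_nbhd \<epsilon> (?B s)) \<le> prob (?B (s + L * \<epsilon>))"
          using L(2)[OF h(3)] by (intro finite_measure_mono) auto
        then have "prob (open_nbhd \<epsilon> (?B s)) - prob (?B s) \<le> cdf M (s + L * \<epsilon>) - cdf M s"
          using h(3) \<open>s < r\<close> by (simp add: cdfM)
        also have "\<dots> \<le> (d s + 1) * (L * \<epsilon>)" using e(2)[OF h(1,2)] h(1) by (simp only: pos_divide_less_eq less_imp_le)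
        finally show ?case by (simp add: mult.assoc)
      qed
      then show "boundary_measure \<mu> (?B s) < \<infinity>" by (rule boundary_measure_finiteI)
    qed
  qed
qed

text \<open>
  Lindelof's theorem for the interiors of coordinate balls. The larger radii \<open>r k\<close> keep room for
  neighbourhoods of the balls of radius \<open>\<rho> k\<close>.
\<close>

lemma countable_coord_ball_cover:
  obtains c :: "nat \<Rightarrow> ('a, 'n) chart" and p :: "nat \<Rightarrow> 'a" and \<rho> :: "nat \<Rightarrow> real" and r :: "nat \<Rightarrow> real"
  where "\<And>k. c k \<in> \<A>" "\<And>k. 0 < \<rho> k" "\<And>k. \<rho> k < r k" "\<And>k. cball (chart_map (c k) (p k)) (r k) \<subseteq> chart_image (c k)"
    "\<And>k. boundary_measure \<mu> (coord_ball (c k) (p k) (\<rho> k)) < \<infinity>" "(\<Union>k. coord_ball (c k) (p k) (\<rho> k)) = UNIV"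
proof -
  have "\<exists>c r \<rho>. c \<in> \<A> \<and> p \<in> chart_dom c \<and> 0 < \<rho> \<and> \<rho> < r \<and> cball (chart_map c p) r \<subseteq> chart_image c \<and>
     boundary_measure \<mu> (coord_ball c p \<rho>) < \<infinity>" for p
  proof -
    obtain c where c: "c \<in> \<A>" "p \<in> chart_dom c" using charts_cover by blast
    obtain r where r: "0 < r" "cball (chart_map c p) r \<subseteq> chart_image c"
      using chart_props(2)[OF c(1)] c(2) open_contains_cball by (metis imageI)
    have "\<exists>\<rho>. 0 < \<rho> \<and> \<rho> < r \<and> boundary_measure \<mu> (coord_ball c p \<rho>) < \<infinity>"
    proof (rule ccontr)
      assume no: "\<not> ?thesis"
      from AE_coord_ball_finite_boundary[OF c(1) r] have "AE s in lborel. s \<notin> {0<..<r}"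
        by eventually_elim (use no in auto)
      then have "{0<..<r} \<in> null_sets lborel" by (subst AE_iff_null_sets) auto
      then have "emeasure lborel {0<..<r} = 0" by (rule null_setsD1)
      then show False using r by simp
    qed
    then show ?thesis using c r by blast
  qed
  then obtain c r \<rho> where *: "\<And>p. c p \<in> \<A>" "\<And>p. p \<in> chart_dom (c p)" "\<And>p. 0 < \<rho> p" "\<And>p. \<rho> p < r p"
    "\<And>p. cball (chart_map (c p) p) (r p) \<subseteq> chart_image (c p)"
    "\<And>p. boundary_measure \<mu> (coord_ball (c p) p (\<rho> p)) < \<infinity>" by metis
  define W where "W p = chart_dom (c p) \<inter> chart_map (c p) -` ball (chart_map (c p) p) (\<rho> p)" for p
  have oW: "open (W p)" for p
    unfolding W_def using chart_props(1,3)[OF *(1)] by (auto intro: continuous_open_preimage)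
  have pW: "p \<in> W p" for p using *(2,3) by (simp add: W_def)
  have Wsub: "W p \<subseteq> coord_ball (c p) p (\<rho> p)" for p by (auto simp: W_def coord_ball_def dist_commute)
  obtain F where F: "F \<subseteq> range W" "countable F" "\<Union>F = \<Union>(range W)"
    using Lindelof[of "range W"] oW by auto
  then obtain C where C: "countable C" "F = W ` C" by (metis countable_subset_image)
  have cov: "(\<Union>p\<in>C. W p) = UNIV" using F(3) C(2) pW by auto
  then have "C \<noteq> {}" by auto
  then have rng: "range (from_nat_into C) = C" using C(1) by (rule range_from_nat_into)
  define q where "q = from_nat_into C"
  show ?thesis
  proof (rule that[of "\<lambda>k. c (q k)" "\<lambda>k. \<rho> (q k)" "\<lambda>k. r (q k)" q])
    have "x \<in> (\<Union>k. coord_ball (c (q k)) (q k) (\<rho> (q k)))" for x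
    proof -
      obtain p where p: "p \<in> C" "x \<in> W p" using cov by blast
      then obtain k where "q k = p" using rng unfolding q_def by (metis imageE)
      then show ?thesis using p Wsub by blast
    qed
    then show "(\<Union>k. coord_ball (c (q k)) (q k) (\<rho> (q k))) = UNIV" by auto
  qed (use * in auto)
qed

text \<open>
  If \<open>k\<close> is the first index of a ball that contains \<open>x\<close>, let \<open>f x = k + s / (2 * \<rho> k)\<close>, where \<open>s\<close> is the coordinate radius of
  \<open>x\<close> in that ball. The factor 2 separates the layers: \<open>f\<close> takes the \<open>k\<close>-th layer to \<open>[k, k + 1/2]\<close>. Each sublevel set at a
  level in such an interval is the union of the first \<open>k\<close> balls and a smaller ball concentric with the next one.
\<close>

theorem AE_isoperimetric_profile_finite:
  "AE v in lborel. 0 < v \<and> v < 1 \<longrightarrow> isoperimetric_profile \<mu> v < \<infinity>"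
proof -
  obtain c p \<rho> r where c: "\<And>k::nat. c k \<in> \<A>" and \<rho>: "\<And>k. 0 < \<rho> k" "\<And>k. \<rho> k < r k"
    and r: "\<And>k. cball (chart_map (c k) (p k)) (r k) \<subseteq> chart_image (c k)"
    and fin: "\<And>k. boundary_measure \<mu> (coord_ball (c k) (p k) (\<rho> k)) < \<infinity>"
    and cover: "(\<Union>k. coord_ball (c k) (p k) (\<rho> k)) = UNIV"
    by (rule countable_coord_ball_cover) (rule that)
  define u where "u k = coord_radius (c k) (p k)" for k
  define Q where "Q k = coord_ball (c k) (p k) (\<rho> k)" for k
  have u[measurable]: "u k \<in> borel_measurable borel" for k unfolding u_def by (rule coord_radius_measurable[OF c])
  have Q[measurable]: "Q k \<in> sets borel" for k unfolding Q_def by (rule coord_ball_measurable[OF c])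
  have ball[measurable]: "coord_ball (c k) (p k) s \<in> sets borel" for k s by (rule coord_ball_measurable[OF c])
  have Qu: "x \<in> Q k \<longleftrightarrow> 0 \<le> u k x \<and> u k x \<le> \<rho> k" for x k by (simp add: Q_def u_def coord_ball_eq)
  define idx where "idx x = (LEAST k. x \<in> Q k)" for x
  have "x \<in> (\<Union>k. Q k)" for x unfolding Q_def cover by simp
  then have idx: "x \<in> Q (idx x)" for x unfolding idx_def by (metis LeastI UN_iff)
  have idx_le: "idx x \<le> k" if "x \<in> Q k" for x k unfolding idx_def using that by (rule Least_le)
  define f where "f x = real (idx x) + u (idx x) x / (2 * \<rho> (idx x))" for x
  have idxm[measurable]: "idx \<in> borel \<rightarrow>\<^sub>M count_space UNIV" unfolding idx_def by measurable
  have f[measurable]: "f \<in> borel_measurable borel"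
    unfolding f_def by (rule measurable_compose_countable[OF _ idxm]) measurable
  have f_range: "real (idx x) \<le> f x" "f x \<le> real (idx x) + 1/2" for x
    using idx[of x] \<rho>(1)[of "idx x"] by (auto simp: f_def Qu field_simps)
  have sublevel: "{x. f x \<le> real k + s / (2 * \<rho> k)} = (\<Union>i<k. Q i) \<union> coord_ball (c k) (p k) s"
    if s: "0 \<le> s" "s \<le> \<rho> k" for k s
  proof (rule set_eqI)
    fix x
    have t: "real k \<le> real k + s / (2 * \<rho> k)" "real k + s / (2 * \<rho> k) \<le> real k + 1/2"
      using s \<rho>(1)[of k] by (auto simp: field_simps)
    have bs: "x \<in> coord_ball (c k) (p k) s \<longleftrightarrow> 0 \<le> u k x \<and> u k x \<le> s" by (simp add: u_def coord_ball_eq)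
    consider "idx x < k" | "idx x = k" | "k < idx x" by linarith
    then show "x \<in> {x. f x \<le> real k + s / (2 * \<rho> k)} \<longleftrightarrow> x \<in> (\<Union>i<k. Q i) \<union> coord_ball (c k) (p k) s"
    proof cases
      case 1
      then have "real (idx x) + 1 \<le> real k" by simp
      then have "f x \<le> real k + s / (2 * \<rho> k)" using f_range(2)[of x] t by linarith
      then show ?thesis using 1 idx[of x] by auto
    next
      case 2
      have "x \<notin> Q i" if "i < k" for i using idx_le[of x i] 2 that by auto
      moreover have "0 \<le> u k x" using idx[of x] 2 by (simp add: Qu)
      moreover have "f x \<le> real k + s / (2 * \<rho> k) \<longleftrightarrow> u k x \<le> s"
        using 2 \<rho>(1)[of k] by (simp add: f_def divide_le_cancel)
      ultimately show ?thesis using bs by auto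
    next
      case 3
      then have "real k + 1 \<le> real (idx x)" by simp
      then have "\<not> f x \<le> real k + s / (2 * \<rho> k)" using f_range(1)[of x] t by linarith
      moreover have "x \<notin> Q i" if "i \<le> k" for i using idx_le[of x i] 3 that by auto
      moreover have "x \<in> Q k" if "x \<in> coord_ball (c k) (p k) s" using that bs s by (simp add: Qu)
      ultimately show ?thesis by fastforce
    qed
  qed
  define M where "M = distr \<mu> borel f"
  interpret M: real_distribution M unfolding M_def by (rule real_distribution_distr) simp
  interpret M: cdf_distribution M by (simp add: cdf_distribution_def M.real_distribution_axioms)
  have ac: "absolutely_continuous lborel M"
    unfolding absolutely_continuous_def
  proof
    fix N :: "real set" assume N: "N \<in> null_sets lborel"
    have [measurable]: "N \<in> sets borel" using N by auto
    have null: "{x \<in> Q k. u k x \<in> {s. real k + 1 / (2 * \<rho> k) * s \<in> N}} \<in> null_sets \<mu>" for k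
      unfolding Q_def u_def using \<rho>(1)[of k] by (intro coord_radius_null_vimage c null_sets_affine_vimage N) auto
    have "{x. f x \<in> N} \<subseteq> (\<Union>k. {x \<in> Q k. u k x \<in> {s. real k + 1 / (2 * \<rho> k) * s \<in> N}})"
      using idx by (auto simp: f_def)
    moreover have "(\<Union>k. {x \<in> Q k. u k x \<in> {s. real k + 1 / (2 * \<rho> k) * s \<in> N}}) \<in> null_sets \<mu>"
      using null by (rule null_sets_UN)
    moreover have "{x. f x \<in> N} \<in> sets \<mu>" by simp
    ultimately have "{x. f x \<in> N} \<in> null_sets \<mu>" by (rule null_sets_subset[rotated 2])
    then have "emeasure M N = 0" unfolding M_def by (subst emeasure_distr) (auto simp: vimage_def)
    then show "N \<in> null_sets M" using N by (auto simp: null_sets_def)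
  qed
  have good: "AE t in M. boundary_measure \<mu> {x. f x \<le> t} < \<infinity>"
  proof -
    have "AE t in lborel. \<forall>k. 2 * \<rho> k * (t - real k) < r k \<longrightarrow>
        boundary_measure \<mu> (coord_ball (c k) (p k) (2 * \<rho> k * (t - real k))) < \<infinity>"
      unfolding AE_all_countable
    proof
      fix k
      have "0 < r k" using \<rho>[of k] by simp
      from AE_E3[OF AE_coord_ball_finite_boundary[OF c this r]]
      obtain N where N: "N \<in> null_sets lborel"
        "\<And>s. s \<notin> N \<Longrightarrow> s < r k \<longrightarrow> boundary_measure \<mu> (coord_ball (c k) (p k) s) < \<infinity>" by auto
      have "{t. - (2 * \<rho> k * real k) + 2 * \<rho> k * t \<in> N} \<in> null_sets lborel"
        using \<rho>(1)[of k] by (intro null_sets_affine_vimage N) auto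
      from AE_not_in[OF this]
      show "AE t in lborel. 2 * \<rho> k * (t - real k) < r k \<longrightarrow>
        boundary_measure \<mu> (coord_ball (c k) (p k) (2 * \<rho> k * (t - real k))) < \<infinity>"
      proof eventually_elim
        case (elim t)
        then show ?case using N(2)[of "2 * \<rho> k * (t - real k)"] by (simp add: algebra_simps)
      qed
    qed
    then have "AE t in M. \<forall>k. 2 * \<rho> k * (t - real k) < r k \<longrightarrow>
        boundary_measure \<mu> (coord_ball (c k) (p k) (2 * \<rho> k * (t - real k))) < \<infinity>"
      by (rule absolutely_continuous_AE[rotated 2]) (auto simp: ac)
    moreover have "AE t in M. \<exists>k. real k \<le> t \<and> t \<le> real k + 1/2"
      unfolding M_def by (subst AE_distr_iff) (use f_range in auto)
    ultimately show ?thesis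
    proof eventually_elim
      case (elim t)
      then obtain k where k: "real k \<le> t" "t \<le> real k + 1/2" by blast
      define s where "s = 2 * \<rho> k * (t - real k)"
      have "2 * \<rho> k * (t - real k) \<le> 2 * \<rho> k * (1/2)" using k \<rho>(1)[of k] by (intro mult_left_mono) auto
      then have s: "0 \<le> s" "s \<le> \<rho> k" using k \<rho>(1)[of k] by (auto simp: s_def)
      have t: "t = real k + s / (2 * \<rho> k)" using \<rho>(1)[of k] by (simp add: s_def)
      have "boundary_measure \<mu> (coord_ball (c k) (p k) s) < \<infinity>"
        using elim(1) s \<rho>(2)[of k] by (auto simp: s_def)
      then have "boundary_measure \<mu> ((\<Union>i<k. Q i) \<union> coord_ball (c k) (p k) s) < \<infinity>"
        using fin by (intro boundary_measure_Un_finite boundary_measure_UN_finite) (auto simp: Q_def)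
      then show ?case unfolding t sublevel[OF s] .
    qed
  qed
  have cont: "continuous_on UNIV (cdf M)"
  proof -
    have "measure M {t} = 0" for t
    proof -
      have "{t} \<in> null_sets lborel" by (simp add: null_sets_def)
      then have "{t} \<in> null_sets M" using ac by (auto simp: absolutely_continuous_def)
      then show ?thesis by (simp add: measure_def null_setsD1)
    qed
    then show ?thesis by (simp add: continuous_on_eq_continuous_at M.isCont_cdf)
  qed
  from M.AE_quantile[OF good] show ?thesis
  proof eventually_elim
    case (elim v)
    show ?case
    proof
      assume v: "0 < v \<and> v < 1"
      define t where "t = Inf {x. v \<le> cdf M x}"
      have "cdf M t = v" unfolding t_def using v by (intro M.cdf_quantile cont) auto
      moreover have "cdf M t = prob {x. f x \<le> t}"
        unfolding cdf_def M_def by (subst measure_distr) (auto simp: vimage_def)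
      ultimately have "isoperimetric_profile \<mu> v \<le> boundary_measure \<mu> {x. f x \<le> t}"
        unfolding isoperimetric_profile_def by (intro INF_lower) auto
      also have "\<dots> < \<infinity>" using elim v by (simp add: t_def)
      finally show "isoperimetric_profile \<mu> v < \<infinity>" .
    qed
  qed
qed

end

theorem corollary6p3:
  fixes \<A> :: "('a::{metric_space, second_countable_topology}, 'n::finite) chart set"
    and g :: "('a, 'n) chart \<Rightarrow> real ^ 'n \<Rightarrow> real ^ 'n ^ 'n"
    and \<mu> :: "'a measure"
  assumes manifold: "connected_riemannian_manifold \<A> g"
    and complete: "uniform_space_class.complete (UNIV :: 'a set)"
    and prob: "prob_space \<mu>" "sets \<mu> = sets borel"
    and full_support: "measure_support \<mu> = UNIV"
    and abs_cont: "absolutely_continuous (riemannian_volume \<A> g) \<mu>"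
    and density_bounded: "\<And>p r. \<exists>C::real. AE x in riemannian_volume \<A> g.
          x \<in> ball p r \<longrightarrow> RN_deriv (riemannian_volume \<A> g) \<mu> x \<le> ennreal C"
    and cheeger: "0 < cheeger_constant \<mu>"
  shows "\<exists>\<nu>\<in>connected_ac_distributions. AE t in lborel.
           cdf \<nu> differentiable (at t) \<and>
           isoperimetric_profile \<mu> (cdf \<nu> t) = ereal (deriv (cdf \<nu>) t)"
proof -
  interpret prob_space \<mu> by fact
  interpret riemannian_probability \<A> g \<mu>
    by unfold_locales (use manifold prob abs_cont in auto)
  obtain h where "0 < ereal h" "ereal h < cheeger_constant \<mu>" using ereal_dense2[OF cheeger] by blast
  then have h: "0 < h" "ereal h < cheeger_constant \<mu>" by auto
  show ?thesis
  proof (rule ex_distribution_with_derivative_profile[OF isoperimetric_profile_0 isoperimetric_profile_1 h(1)])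
    show "ereal (h * min v (1 - v)) \<le> isoperimetric_profile \<mu> v" if "0 < v" "v < 1" for v
      using isoperimetric_profile_lower_bound[OF h(2) that] .
    show "{v. 0 < v \<and> v < 1 \<and> isoperimetric_profile \<mu> v < ereal c} \<in> sets lebesgue" for c
      by (rule profile_sublevel_lebesgue_measurable[OF h])
  qed (rule AE_isoperimetric_profile_finite)
qed

end
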